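(* Let $X$ be a Banach space, let $\mathcal{T}=\{T(t,s)\}_{t\ge s\ge 0}$ be an evolution family on $X$, let $\rho\colon[0,\infty)\to[0,\infty)$ be a strictly increasing $C^1$ function with $\rho(0)=0$ and $\lim_{t\to\infty}\rho(t)=\infty$, and let $\{\|\cdot\|_t\}_{t\ge 0}$ be a family of norms on $X$ such that $t\mapsto\|x\|_t$ is continuous for each $x\in X$ and there exist $C>0$, $\varepsilon\ge 0$ with $\|x\|\le\|x\|_t\le Ce^{\varepsilon\rho(t)}\|x\|$ for all $x\in X$, $t\ge 0$. Assume that $\mathcal{T}$ admits a $\rho$-dichotomy with respect to the family of norms $\|\cdot\|_t$, $t\ge 0$, with projections $P(t)$, $t\ge0$, and set $Z=\operatorname{Ker}P(0)$. Then for each $y\in Y_1$ there exists a unique $x\in Y_\infty^Z$ such that $$x(t)=T(t,s)x(s)+\int_s^t T(t,\tau)y(\tau)\,d\tau\quad\text{for all } t\ge s\ge 0.$$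
   Context: $\mathcal{B}(X)$ is the algebra of bounded linear operators on the Banach space $(X,\|\cdot\|)$. A family $\{T(t,s)\}_{t\ge s\ge 0}\subset\mathcal{B}(X)$ is an evolution family if $T(t,t)=\mathrm{Id}$ for $t\ge 0$; $T(t,s)T(s,\tau)=T(t,\tau)$ for $t\ge s\ge\tau\ge 0$; and for all $s\ge 0$, $x\in X$ the map $t\mapsto T(t,s)x$ is continuous on $[s,\infty)$ and the map $t\mapsto T(s,t)x$ is continuous on $[0,s]$. Function spaces: $Y_1$ is the Banach space of all Bochner measurable $x\colon[0,\infty)\to X$ (identified up to a.e. equality) with $\|x\|_1:=\int_0^\infty\|x(t)\|_t\,dt<\infty$. $Y_\infty$ is the Banach space of all continuous $x\colon[0,\infty)\to X$ with $\|x\|_\infty:=\sup_{t\ge 0}\|x(t)\|_t<\infty$. For a closed subspace $Z\subset X$, $Y_\infty^Z=\{x\in Y_\infty: x(0)\in Z\}$. $\rho$-dichotomy: $\mathcal{T}$ admits a $\rho$-dichotomy with respect to the norms $\|\cdot\|_t$ if there is a family $\{P(t)\}_{t\ge 0}$ of projections on $X$ with $T(t,s)P(s)=P(t)T(t,s)$ for $t\ge s\ge 0$, such that $T(t,s)|_{\operatorname{Ker}P(s)}\colon\operatorname{Ker}P(s)\to\operatorname{Ker}P(t)$ is invertible for all $t\ge s\ge 0$, and there are constants $\lambda,D>0$ such that for all $x\in X$: $\|T(t,s)P(s)x\|_t\le De^{-\lambda(\rho(t)-\rho(s))}\|x\|_s$ for $t\ge s\ge 0$, and $\|T(t,s)(\mathrm{Id}-P(s))x\|_t\le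 De^{-\lambda(\rho(s)-\rho(t))}\|x\|_s$ for $0\le t\le s$, where for $0\le t\le s$ one sets $T(t,s):=(T(s,t)|_{\operatorname{Ker}P(t)})^{-1}\colon\operatorname{Ker}P(s)\to\operatorname{Ker}P(t)$. *)

theory Defs
  imports "HOL-Analysis.Analysis"
begin

text \<open>
  The library's Bochner integral is restricted to second countable (hence separable) target
  spaces, and there Borel measurability coincides with strong measurability.  For an arbitrary
  Banach space neither applies, so the classical notions are introduced here on top of
  \<^const>\<open>simple_function\<close> and \<^const>\<open>Bochner_Integration.simple_bochner_integral\<close>.
  They are meant for complete measures such as \<^term>\<open>lebesgue_on S\<close> with Lebesgue measurable
  \<open>S\<close>: otherwise the norm of an almost-everywhere limit of simple functions may fail to be
  measurable.
\<close>

definition bochner_measurable :: "'b measure \<Rightarrow> ('b \<Rightarrow> 'a::real_normed_vector) \<Rightarrow> bool" where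
  "bochner_measurable M f \<longleftrightarrow>
     (\<exists>s. (\<forall>i. simple_function M (s i)) \<and> (AE x in M. (\<lambda>i::nat. s i x) \<longlonglongrightarrow> f x))"

definition has_banach_bochner_integral ::
    "'b measure \<Rightarrow> ('b \<Rightarrow> 'a::real_normed_vector) \<Rightarrow> 'a \<Rightarrow> bool" where
  "has_banach_bochner_integral M f I \<longleftrightarrow>
     bochner_measurable M f \<and>
     (\<exists>s. (\<forall>i. Bochner_Integration.simple_bochner_integrable M (s i)) \<and>
          (\<lambda>i::nat. \<integral>\<^sup>+ x. ennreal (norm (f x - s i x)) \<partial>M) \<longlonglongrightarrow> 0 \<and>
          (\<lambda>i. Bochner_Integration.simple_bochner_integral M (s i)) \<longlonglongrightarrow> I)"

definition banach_bochner_integrable ::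
    "'b measure \<Rightarrow> ('b \<Rightarrow> 'a::real_normed_vector) \<Rightarrow> bool" where
  "banach_bochner_integrable M f \<longleftrightarrow> (\<exists>I. has_banach_bochner_integral M f I)"

definition banach_bochner_integral ::
    "'b measure \<Rightarrow> ('b \<Rightarrow> 'a::real_normed_vector) \<Rightarrow> 'a" where
  "banach_bochner_integral M f = (THE I. has_banach_bochner_integral M f I)"

definition is_norm :: "('a::real_vector \<Rightarrow> real) \<Rightarrow> bool" where
  "is_norm N \<longleftrightarrow>
     (\<forall>x. 0 \<le> N x) \<and> (\<forall>x. N x = 0 \<longleftrightarrow> x = 0) \<and>
     (\<forall>c x. N (c *\<^sub>R x) = \<bar>c\<bar> * N x) \<and> (\<forall>x y. N (x + y) \<le> N x + N y)"

text \<open>Only the values at times \<open>t \<ge> s \<ge> 0\<close> are constrained.\<close>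

definition evolution_family :: "(real \<Rightarrow> real \<Rightarrow> 'a::real_normed_vector \<Rightarrow>\<^sub>L 'a) \<Rightarrow> bool" where
  "evolution_family T \<longleftrightarrow>
     (\<forall>t\<ge>0. T t t = id_blinfun) \<and>
     (\<forall>t s r. 0 \<le> r \<and> r \<le> s \<and> s \<le> t \<longrightarrow> T t s o\<^sub>L T s r = T t r) \<and>
     (\<forall>s\<ge>0. \<forall>x. continuous_on {s..} (\<lambda>t. blinfun_apply (T t s) x)) \<and>
     (\<forall>s\<ge>0. \<forall>x. continuous_on {0..s} (\<lambda>t. blinfun_apply (T s t) x))"

definition blinfun_ker :: "('a::real_normed_vector \<Rightarrow>\<^sub>L 'b::real_normed_vector) \<Rightarrow> 'a set" where
  "blinfun_ker A = {x. blinfun_apply A x = 0}"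

text \<open>For \<open>0 \<le> t \<le> s\<close>, \<open>backward_evolution T P t s\<close> is the inverse of
  \<open>T s t : Ker (P t) \<rightarrow> Ker (P s)\<close>; its values outside \<open>Ker (P s)\<close> are irrelevant.\<close>

definition backward_evolution ::
    "(real \<Rightarrow> real \<Rightarrow> 'a::real_normed_vector \<Rightarrow>\<^sub>L 'a) \<Rightarrow> (real \<Rightarrow> 'a \<Rightarrow>\<^sub>L 'a) \<Rightarrow>
     real \<Rightarrow> real \<Rightarrow> 'a \<Rightarrow> 'a" where
  "backward_evolution T P t s = inv_into (blinfun_ker (P t)) (blinfun_apply (T s t))"

definition rho_dichotomy ::
    "(real \<Rightarrow> real) \<Rightarrow> (real \<Rightarrow> 'a::real_normed_vector \<Rightarrow> real) \<Rightarrow>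
     (real \<Rightarrow> real \<Rightarrow> 'a \<Rightarrow>\<^sub>L 'a) \<Rightarrow> (real \<Rightarrow> 'a \<Rightarrow>\<^sub>L 'a) \<Rightarrow> bool" where
  "rho_dichotomy \<rho> N T P \<longleftrightarrow>
     (\<forall>t\<ge>0. P t o\<^sub>L P t = P t) \<and>
     (\<forall>t s. 0 \<le> s \<and> s \<le> t \<longrightarrow> T t s o\<^sub>L P s = P t o\<^sub>L T t s) \<and>
     (\<forall>t s. 0 \<le> s \<and> s \<le> t \<longrightarrow>
        bij_betw (blinfun_apply (T t s)) (blinfun_ker (P s)) (blinfun_ker (P t))) \<and>
     (\<exists>l>0. \<exists>D>0. \<forall>x.
        (\<forall>t s. 0 \<le> s \<and> s \<le> t \<longrightarrow>
           N t (blinfun_apply (T t s) (blinfun_apply (P s) x))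
             \<le> D * exp (- l * (\<rho> t - \<rho> s)) * N s x) \<and>
        (\<forall>t s. 0 \<le> t \<and> t \<le> s \<longrightarrow>
           N t (backward_evolution T P t s (x - blinfun_apply (P s) x))
             \<le> D * exp (- l * (\<rho> s - \<rho> t)) * N s x))"

text \<open>Elements of \<open>Y\<^sub>1\<close> are represented by functions instead of almost-everywhere classes.\<close>

definition Y_one :: "(real \<Rightarrow> 'a::real_normed_vector \<Rightarrow> real) \<Rightarrow> (real \<Rightarrow> 'a) set" where
  "Y_one N = {y. bochner_measurable (lebesgue_on {0..}) y \<and>
                 (\<integral>\<^sup>+ t. ennreal (N t (y t)) \<partial>lebesgue_on {0..}) < \<infinity>}"

text \<open>Functions on \<open>[0,\<infinity>)\<close> are made extensional (\<open>undefined\<close> at negative arguments), so that HOL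
  equality is equality on \<open>[0,\<infinity>)\<close> and unique existence has its intended meaning.\<close>

definition Y_infty :: "(real \<Rightarrow> 'a::real_normed_vector \<Rightarrow> real) \<Rightarrow> (real \<Rightarrow> 'a) set" where
  "Y_infty N = {x. x \<in> extensional {0..} \<and> continuous_on {0..} x \<and>
                   bdd_above ((\<lambda>t. N t (x t)) ` {0..})}"

definition Y_infty_sub ::
    "(real \<Rightarrow> 'a::real_normed_vector \<Rightarrow> real) \<Rightarrow> 'a set \<Rightarrow> (real \<Rightarrow> 'a) set" where
  "Y_infty_sub N Z = {x \<in> Y_infty N. x 0 \<in> Z}"

end

theory Submission imports Defs begin

text \<open>
  For \<open>s \<ge> 0\<close> let \<open>G s\<close> be \<open>Id - P s\<close> followed by the inverse of \<open>T s 0 : Ker (P 0) \<rightarrow> Ker (P s)\<close>.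
  Since \<open>G s = G t T(t,s)\<close> for \<open>s \<le> t\<close>, the map \<open>s \<mapsto> G s v\<close> inherits continuity from the evolution
  family, and Green's formula
  \<open>x(t) = \<integral>\<^sub>0\<^sup>t T(t,\<tau>) P(\<tau>) y(\<tau>) d\<tau> - \<integral>\<^sub>t\<^sup>\<infinity> T(t,\<tau>) (Id - P(\<tau>)) y(\<tau>) d\<tau>\<close> becomes
  \<open>x(t) = \<integral>\<^sub>0\<^sup>t T(t,\<tau>) y(\<tau>) d\<tau> - T(t,0) \<integral>\<^sub>0\<^sup>\<infinity> G(\<tau>) y(\<tau>) d\<tau>\<close>, in which no projection has to be measured.
  The integrand is dominated by \<open>D \<parallel>y(\<tau>)\<parallel>\<^sub>\<tau>\<close> in the norm \<open>\<parallel>\<cdot>\<parallel>\<^sub>t\<close>, for every \<open>t\<close>: this bounds \<open>x\<close>, and dominated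
  convergence gives continuity. The difference of two solutions is an orbit \<open>T(t,0) z\<close> with
  \<open>z \<in> Ker (P 0)\<close>; if it is bounded, the backward estimate forces \<open>z = 0\<close>.
\<close>

section \<open>Bochner integration in arbitrary Banach spaces\<close>

lemma bochner_measurableE:
  assumes "bochner_measurable M f"
  obtains s where "\<And>i::nat. simple_function M (s i)" "AE x in M. (\<lambda>i. s i x) \<longlonglongrightarrow> f x"
  using assms unfolding bochner_measurable_def by auto

lemma bochner_measurableI:
  assumes "\<And>i::nat. simple_function M (s i)" "AE x in M. (\<lambda>i. s i x) \<longlonglongrightarrow> f x"
  shows "bochner_measurable M f"
  using assms unfolding bochner_measurable_def by (intro exI[of _ s]) simp

lemma has_banach_bochner_integralE:
  assumes "has_banach_bochner_integral M f I"
  obtains s where "bochner_measurable M f"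
    "\<And>i::nat. Bochner_Integration.simple_bochner_integrable M (s i)"
    "(\<lambda>i. \<integral>\<^sup>+ x. ennreal (norm (f x - s i x)) \<partial>M) \<longlonglongrightarrow> 0"
    "(\<lambda>i. Bochner_Integration.simple_bochner_integral M (s i)) \<longlonglongrightarrow> I"
  using assms unfolding has_banach_bochner_integral_def by auto

lemma has_banach_bochner_integralI:
  assumes "bochner_measurable M f"
    "\<And>i::nat. Bochner_Integration.simple_bochner_integrable M (s i)"
    "(\<lambda>i. \<integral>\<^sup>+ x. ennreal (norm (f x - s i x)) \<partial>M) \<longlonglongrightarrow> 0"
    "(\<lambda>i. Bochner_Integration.simple_bochner_integral M (s i)) \<longlonglongrightarrow> I"
  shows "has_banach_bochner_integral M f I"
  using assms unfolding has_banach_bochner_integral_def by (intro conjI exI[of _ s]) simp_all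

section \<open>Stability of strong measurability under null sets, continuous maps, algebra and
  restriction\<close>

lemma bochner_measurable_cong_AE:
  assumes "bochner_measurable M f" "AE x in M. f x = g x"
  shows "bochner_measurable M g"
proof -
  from assms(1) obtain s where s: "\<And>i::nat. simple_function M (s i)" "AE x in M. (\<lambda>i. s i x) \<longlonglongrightarrow> f x"
    by (rule bochner_measurableE) blast
  from s(2) assms(2) have "AE x in M. (\<lambda>i. s i x) \<longlonglongrightarrow> g x"
    by eventually_elim simp
  with s(1) show ?thesis by (rule bochner_measurableI)
qed

lemma bochner_measurable_simple: "simple_function M f \<Longrightarrow> bochner_measurable M f"
  unfolding bochner_measurable_def by (intro exI[of _ "\<lambda>_. f"]) simp

lemma bochner_measurable_simple_bochner_integrable:
  "Bochner_Integration.simple_bochner_integrable M f \<Longrightarrow> bochner_measurable M f"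
  by (erule simple_bochner_integrable.cases) (rule bochner_measurable_simple)

lemma bochner_measurable_compose:
  assumes "bochner_measurable M f" "continuous_on UNIV g"
  shows "bochner_measurable M (\<lambda>x. g (f x))"
proof -
  from assms(1) obtain s where s: "\<And>i::nat. simple_function M (s i)" "AE x in M. (\<lambda>i. s i x) \<longlonglongrightarrow> f x"
    by (rule bochner_measurableE) blast
  from s(2) have "AE x in M. (\<lambda>i. g (s i x)) \<longlonglongrightarrow> g (f x)"
    by eventually_elim (rule continuous_on_tendsto_compose[OF assms(2)], auto)
  with s(1) show ?thesis unfolding bochner_measurable_def
    by (intro exI[of _ "\<lambda>i x. g (s i x)"]) (simp add: simple_function_compose1)
qed

lemma bochner_measurable_Pair:
  assumes "bochner_measurable M f" "bochner_measurable M g"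
  shows "bochner_measurable M (\<lambda>x. (f x, g x))"
proof -
  from assms(1) obtain s where s: "\<And>i::nat. simple_function M (s i)" "AE x in M. (\<lambda>i. s i x) \<longlonglongrightarrow> f x"
    by (rule bochner_measurableE) blast
  from assms(2) obtain t where t: "\<And>i::nat. simple_function M (t i)" "AE x in M. (\<lambda>i. t i x) \<longlonglongrightarrow> g x"
    by (rule bochner_measurableE) blast
  from s(2) t(2) have "AE x in M. (\<lambda>i. (s i x, t i x)) \<longlonglongrightarrow> (f x, g x)"
    by eventually_elim (rule tendsto_Pair)
  with s(1) t(1) show ?thesis unfolding bochner_measurable_def
    by (intro exI[of _ "\<lambda>i x. (s i x, t i x)"]) simp
qed

lemma bochner_measurable_diff:
  assumes "bochner_measurable M f" "bochner_measurable M g"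
  shows "bochner_measurable M (\<lambda>x. f x - g x)"
  using bochner_measurable_compose[OF bochner_measurable_Pair[OF assms]
      continuous_on_diff[OF continuous_on_fst[OF continuous_on_id] continuous_on_snd[OF continuous_on_id]]]
  by simp

lemma bochner_measurable_norm:
  "bochner_measurable M f \<Longrightarrow> bochner_measurable M (\<lambda>x. norm (f x))"
  using bochner_measurable_compose[of M f norm] by (simp add: continuous_on_norm_id)

lemma borel_measurable_imp_bochner_measurable:
  fixes f :: "'b \<Rightarrow> 'a::{real_normed_vector, second_countable_topology}"
  assumes "f \<in> borel_measurable M"
  shows "bochner_measurable M f"
proof -
  obtain F where "\<forall>i. simple_function M (F i)" "\<forall>x\<in>space M. (\<lambda>i. F i x) \<longlonglongrightarrow> f x"
    using borel_measurable_implies_sequence_metric[OF assms, of 0] by auto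
  then show ?thesis by (intro bochner_measurableI[of M F]) auto
qed

lemma bochner_measurable_scaleR:
  assumes "c \<in> borel_measurable M" "bochner_measurable M f"
  shows "bochner_measurable M (\<lambda>x. c x *\<^sub>R f x)"
  using bochner_measurable_compose[OF bochner_measurable_Pair[OF
      borel_measurable_imp_bochner_measurable[OF assms(1)] assms(2)]
      continuous_on_scaleR[OF continuous_on_fst[OF continuous_on_id] continuous_on_snd[OF continuous_on_id]]]
  by simp

text \<open>Approximants on the subset extend by zero to the whole space. Conversely, approximants
  on the whole space serve unchanged, because the indicator equals 1 on
  \<open>\<Omega>\<close>.\<close>

lemma bochner_measurable_restrict_space:
  assumes "\<Omega> \<inter> space M \<in> sets M"
  shows "bochner_measurable (restrict_space M \<Omega>) f \<longleftrightarrow> bochner_measurable M (\<lambda>x. indicator \<Omega> x *\<^sub>R f x)"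
proof
  assume "bochner_measurable (restrict_space M \<Omega>) f"
  then obtain s where s: "\<And>i::nat. simple_function (restrict_space M \<Omega>) (s i)"
      "AE x in restrict_space M \<Omega>. (\<lambda>i. s i x) \<longlonglongrightarrow> f x"
    by (rule bochner_measurableE) blast
  from s(2) have "AE x in M. (\<lambda>i. indicator \<Omega> x *\<^sub>R s i x) \<longlonglongrightarrow> indicator \<Omega> x *\<^sub>R f x"
    unfolding AE_restrict_space_iff[OF assms] by eventually_elim (auto simp: indicator_def)
  with s(1)[unfolded simple_function_restrict_space[OF assms]]
  show "bochner_measurable M (\<lambda>x. indicator \<Omega> x *\<^sub>R f x)"
    by (rule bochner_measurableI)
next
  assume "bochner_measurable M (\<lambda>x. indicator \<Omega> x *\<^sub>R f x)"
  then obtain s where s: "\<And>i::nat. simple_function M (s i)"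
      "AE x in M. (\<lambda>i. s i x) \<longlonglongrightarrow> indicator \<Omega> x *\<^sub>R f x"
    by (rule bochner_measurableE) blast
  have "simple_function (restrict_space M \<Omega>) (s i)" for i
  proof -
    have "(\<lambda>x. indicator \<Omega> x *\<^sub>R s i x) = (\<lambda>x. if x \<in> \<Omega> then s i x else 0)"
      by auto
    then show ?thesis
      unfolding simple_function_restrict_space[OF assms]
      using simple_function_If_set[OF s(1)[of i] simple_function_const[of M 0] assms] by simp
  qed
  moreover from s(2) have "AE x in restrict_space M \<Omega>. (\<lambda>i. s i x) \<longlonglongrightarrow> f x"
    unfolding AE_restrict_space_iff[OF assms] by eventually_elim auto
  ultimately show "bochner_measurable (restrict_space M \<Omega>) f"
    by (rule bochner_measurableI)
qed

section \<open>Nonnegative integrals of functions that are Borel up to a null set\<close>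

text \<open>Without completeness of \<open>M\<close>, an almost everywhere limit of simple functions
  may fail to be Borel. The pointwise \<open>lim\<close> of the approximants is Borel everywhere and
  agrees with the limit off a null set.\<close>

lemma bochner_measurable_real_borel:
  fixes f :: "'b \<Rightarrow> real"
  assumes "bochner_measurable M f"
  obtains g where "g \<in> borel_measurable M" "AE x in M. f x = g x"
proof -
  from assms obtain s where s: "\<And>i::nat. simple_function M (s i)" "AE x in M. (\<lambda>i. s i x) \<longlonglongrightarrow> f x"
    by (rule bochner_measurableE) blast
  have "(\<lambda>x. lim (\<lambda>i. s i x)) \<in> borel_measurable M"
    by (intro borel_measurable_lim_metric borel_measurable_simple_function s)
  moreover from s(2) have "AE x in M. f x = lim (\<lambda>i. s i x)"
    by eventually_elim (simp add: limI)
  ultimately show ?thesis using that by blast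
qed

text \<open>Linearity holds for Borel representatives, and the integrals ignore null sets. The
  combined form covers scaling (\<open>u\<close> zero) as well as sums
  (\<open>c = 1\<close>).\<close>

lemma nn_integral_linear_bochner_measurable:
  fixes u v :: "'b \<Rightarrow> real"
  assumes "bochner_measurable M u" "bochner_measurable M v"
    and "\<And>x. 0 \<le> u x" "\<And>x. 0 \<le> v x" "0 \<le> c"
  shows "(\<integral>\<^sup>+x. ennreal (u x + c * v x) \<partial>M) = (\<integral>\<^sup>+x. u x \<partial>M) + ennreal c * (\<integral>\<^sup>+x. v x \<partial>M)"
proof -
  obtain u' where [measurable]: "u' \<in> borel_measurable M" and u': "AE x in M. u x = u' x"
    using bochner_measurable_real_borel[OF assms(1)] .
  obtain v' where [measurable]: "v' \<in> borel_measurable M" and v': "AE x in M. v x = v' x"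
    using bochner_measurable_real_borel[OF assms(2)] .
  have "(\<integral>\<^sup>+x. ennreal (u x + c * v x) \<partial>M) = (\<integral>\<^sup>+x. ennreal (u' x) + ennreal c * ennreal (v' x) \<partial>M)"
    using u' v' by (intro nn_integral_cong_AE, eventually_elim)
      (metis assms(3-5) ennreal_mult ennreal_plus mult_nonneg_nonneg)
  also have "\<dots> = (\<integral>\<^sup>+x. ennreal (u' x) \<partial>M) + ennreal c * (\<integral>\<^sup>+x. ennreal (v' x) \<partial>M)"
    by (simp add: nn_integral_add nn_integral_cmult)
  also have "(\<integral>\<^sup>+x. ennreal (u' x) \<partial>M) = (\<integral>\<^sup>+x. ennreal (u x) \<partial>M)"
    using u' by (intro nn_integral_cong_AE, eventually_elim) simp
  also have "(\<integral>\<^sup>+x. ennreal (v' x) \<partial>M) = (\<integral>\<^sup>+x. ennreal (v x) \<partial>M)"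
    using v' by (intro nn_integral_cong_AE, eventually_elim) simp
  finally show ?thesis .
qed

lemma nn_integral_dominated_convergence_bochner_measurable:
  fixes u :: "nat \<Rightarrow> 'b \<Rightarrow> real"
  assumes "\<And>i. bochner_measurable M (u i)" "bochner_measurable M w"
    and "\<And>i. AE x in M. u i x \<le> w x" "(\<integral>\<^sup>+x. w x \<partial>M) < \<infinity>"
    and "AE x in M. (\<lambda>i. u i x) \<longlonglongrightarrow> 0"
  shows "(\<lambda>i. \<integral>\<^sup>+x. u i x \<partial>M) \<longlonglongrightarrow> 0"
proof -
  have "\<forall>i. \<exists>g. g \<in> borel_measurable M \<and> (AE x in M. u i x = g x)"
    using bochner_measurable_real_borel[OF assms(1)] by metis
  then obtain u' where [measurable]: "\<And>i. u' i \<in> borel_measurable M"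
    and u': "\<And>i. AE x in M. u i x = u' i x" by metis
  obtain w' where [measurable]: "w' \<in> borel_measurable M" and w': "AE x in M. w x = w' x"
    using bochner_measurable_real_borel[OF assms(2)] .
  \<comment> \<open>Countably many exceptional null sets are merged into one, so that pointwise
    convergence transfers to the representatives.\<close>
  have all: "AE x in M. \<forall>i. u i x = u' i x"
    using u' by (simp add: AE_all_countable)
  have "(\<integral>\<^sup>+x. w' x \<partial>M) = (\<integral>\<^sup>+x. w x \<partial>M)"
    using w' by (intro nn_integral_cong_AE, eventually_elim) simp
  then have fin: "(\<integral>\<^sup>+x. w' x \<partial>M) < \<infinity>" using assms(4) by simp
  have "(\<lambda>i. \<integral>\<^sup>+x. ennreal (u' i x) \<partial>M) \<longlonglongrightarrow> (\<integral>\<^sup>+x. 0 \<partial>M)"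
  proof (rule nn_integral_dominated_convergence[where w="\<lambda>x. ennreal (w' x)"])
    show "AE x in M. ennreal (u' i x) \<le> ennreal (w' x)" for i
      using assms(3)[of i] u'[of i] w' by eventually_elim (simp add: ennreal_leI)
    show "AE x in M. (\<lambda>i. ennreal (u' i x)) \<longlonglongrightarrow> 0"
      using assms(5) all by eventually_elim (simp flip: ennreal_0)
  qed (use fin in simp_all)
  moreover have "(\<integral>\<^sup>+x. ennreal (u' i x) \<partial>M) = (\<integral>\<^sup>+x. ennreal (u i x) \<partial>M)" for i
    using u'[of i] by (intro nn_integral_cong_AE, eventually_elim) simp
  ultimately show ?thesis by simp
qed

section \<open>The norm inequality for the integral, for any norm dominated by the ambient
  one\<close>

lemma is_norm_norm: "is_norm (norm :: 'a::real_normed_vector \<Rightarrow> real)"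
  by (auto simp: is_norm_def norm_triangle_ineq)

lemma
  assumes "is_norm N"
  shows is_norm_nonneg: "0 \<le> N x"
    and is_norm_eq_0_iff: "N x = 0 \<longleftrightarrow> x = 0"
    and is_norm_scaleR: "N (c *\<^sub>R x) = \<bar>c\<bar> * N x"
    and is_norm_triangle: "N (x + y) \<le> N x + N y"
  using assms unfolding is_norm_def by blast+

lemma is_norm_abs_diff_le:
  assumes "is_norm N"
  shows "\<bar>N x - N y\<bar> \<le> N (x - y)"
proof -
  have "N x \<le> N (x - y) + N y" "N y \<le> N (y - x) + N x"
    using is_norm_triangle[OF assms, of "x - y" y] is_norm_triangle[OF assms, of "y - x" x] by simp_all
  moreover have "N (y - x) = N (x - y)"
    using is_norm_scaleR[OF assms, of "-1" "x - y"] by simp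
  ultimately show ?thesis by linarith
qed

text \<open>By the reverse triangle inequality \<open>N\<close> is Lipschitz for the ambient norm;
  continuity allows composing \<open>N\<close> with strongly measurable functions.\<close>

lemma is_norm_bounded_imp_continuous:
  assumes "is_norm N" "\<And>x. N x \<le> K * norm x"
  shows "continuous_on UNIV N"
  unfolding continuous_on_sequentially
proof (intro allI ballI impI, elim conjE)
  fix u :: "nat \<Rightarrow> 'a" and a assume "u \<longlonglongrightarrow> a"
  then have "(\<lambda>n. K * norm (u n - a)) \<longlonglongrightarrow> K * norm (a - a)"
    by (intro tendsto_intros)
  then have lim: "(\<lambda>n. K * norm (u n - a)) \<longlonglongrightarrow> 0" by simp
  have "norm (N (u n) - N a) \<le> K * norm (u n - a)" for n
    using is_norm_abs_diff_le[OF assms(1), of "u n" a] assms(2)[of "u n - a"] by simp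
  then have "(\<lambda>n. N (u n) - N a) \<longlonglongrightarrow> 0"
    by (intro Lim_null_comparison[OF _ lim] always_eventually allI)
  then show "(N \<circ> u) \<longlonglongrightarrow> N a"
    unfolding comp_def by (rule LIM_zero_cancel)
qed

lemma is_norm_sum_le:
  assumes "is_norm N"
  shows "N (\<Sum>i\<in>A. f i) \<le> (\<Sum>i\<in>A. N (f i))"
proof (induction A rule: infinite_finite_induct)
  case (insert x F)
  then show ?case using is_norm_triangle[OF assms, of "f x" "sum f F"] by simp
qed (use is_norm_eq_0_iff[OF assms, of 0] in simp_all)

lemma simple_bochner_integral_is_norm_le:
  fixes f :: "'b \<Rightarrow> 'a::real_normed_vector"
  assumes N: "is_norm N" and f: "Bochner_Integration.simple_bochner_integrable M f"
  shows "ennreal (N (Bochner_Integration.simple_bochner_integral M f)) \<le> (\<integral>\<^sup>+x. N (f x) \<partial>M)"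
proof -
  have N0: "N 0 = 0" and pos: "\<And>x. 0 \<le> N x" and sc: "\<And>c x. N (c *\<^sub>R x) = \<bar>c\<bar> * N x"
    using is_norm_eq_0_iff[OF N, of 0] is_norm_nonneg[OF N] is_norm_scaleR[OF N] by simp_all
  have int: "Bochner_Integration.simple_bochner_integrable M (\<lambda>x. N (f x))"
    using simple_bochner_integrable_compose2[of "\<lambda>a b. N a", OF N0 f f] .
  have "N (Bochner_Integration.simple_bochner_integral M f) \<le> (\<Sum>y\<in>f ` space M. measure M {x \<in> space M. f x = y} *\<^sub>R N y)"
    unfolding simple_bochner_integral_def
    using is_norm_sum_le[OF N, of "\<lambda>y. measure M {x \<in> space M. f x = y} *\<^sub>R y" "f ` space M"] by (simp add: sc)
  \<comment> \<open>Different values of \<open>f\<close> may have equal \<open>N\<close>, so the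
    integral of the scalar function is computed on the finer partition into level sets of
    \<open>f\<close>.\<close>
  also have "\<dots> = Bochner_Integration.simple_bochner_integral M (\<lambda>x. N (f x))"
    using f int by (intro simple_bochner_integral_partition[symmetric])
      (auto elim: simple_bochner_integrable.cases)
  finally show ?thesis
    using simple_bochner_integral_eq_nn_integral[OF int] pos ennreal_leI by metis
qed

text \<open>The case of simple functions passes to the limit, the error being a multiple of the L1
  distance to the approximants. Working with a general \<open>N\<close> gives uniqueness of the
  integral (for \<open>norm\<close>) and later the bounds in each \<open>N t\<close>.\<close>

lemma has_banach_bochner_integral_is_norm_le:
  assumes N: "is_norm N" "\<And>x. N x \<le> K * norm x"
    and f: "has_banach_bochner_integral M f I"
  shows "ennreal (N I) \<le> (\<integral>\<^sup>+x. N (f x) \<partial>M)"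
proof -
  from f obtain s where m: "bochner_measurable M f"
    and s: "\<And>i::nat. Bochner_Integration.simple_bochner_integrable M (s i)"
      "(\<lambda>i. \<integral>\<^sup>+ x. ennreal (norm (f x - s i x)) \<partial>M) \<longlonglongrightarrow> 0"
      "(\<lambda>i. Bochner_Integration.simple_bochner_integral M (s i)) \<longlonglongrightarrow> I"
    by (rule has_banach_bochner_integralE) blast
  \<comment> \<open>The sign of \<open>K\<close> is not given, whereas linearity of the nonnegative
    integral asks for a nonnegative factor.\<close>
  define L where "L = max K 0"
  have NL: "N x \<le> L * norm x" for x
    using N(2)[of x] mult_right_mono[of K L "norm x"] by (auto simp: L_def)
  have pos: "0 \<le> N x" for x by (rule is_norm_nonneg[OF N(1)])
  note cont = is_norm_bounded_imp_continuous[OF N]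
  have "ennreal (N (Bochner_Integration.simple_bochner_integral M (s i))) \<le>
      (\<integral>\<^sup>+x. N (f x) \<partial>M) + ennreal L * (\<integral>\<^sup>+ x. ennreal (norm (f x - s i x)) \<partial>M)" for i
  proof -
    have "ennreal (N (Bochner_Integration.simple_bochner_integral M (s i))) \<le> (\<integral>\<^sup>+x. N (s i x) \<partial>M)"
      by (rule simple_bochner_integral_is_norm_le[OF N(1) s(1)])
    also have "\<dots> \<le> (\<integral>\<^sup>+x. ennreal (N (f x) + L * norm (f x - s i x)) \<partial>M)"
    proof (intro nn_integral_mono ennreal_leI)
      fix x
      show "N (s i x) \<le> N (f x) + L * norm (f x - s i x)"
        using is_norm_abs_diff_le[OF N(1), of "f x" "s i x"] NL[of "f x - s i x"] by linarith
    qed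
    also have "\<dots> = (\<integral>\<^sup>+x. N (f x) \<partial>M) + ennreal L * (\<integral>\<^sup>+ x. ennreal (norm (f x - s i x)) \<partial>M)"
      by (intro nn_integral_linear_bochner_measurable bochner_measurable_compose[OF m cont]
          bochner_measurable_norm bochner_measurable_diff m
          bochner_measurable_simple_bochner_integrable s(1))
        (simp_all add: L_def pos)
    finally show ?thesis .
  qed
  moreover have "(\<lambda>i. ennreal (N (Bochner_Integration.simple_bochner_integral M (s i)))) \<longlonglongrightarrow> ennreal (N I)"
    by (intro tendsto_ennrealI continuous_on_tendsto_compose[OF cont s(3)]) auto
  moreover have "(\<lambda>i. (\<integral>\<^sup>+x. N (f x) \<partial>M) + ennreal L * (\<integral>\<^sup>+ x. ennreal (norm (f x - s i x)) \<partial>M))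
      \<longlonglongrightarrow> (\<integral>\<^sup>+x. N (f x) \<partial>M) + ennreal L * 0"
    by (intro tendsto_add tendsto_const ennreal_tendsto_cmult s(2)) simp
  ultimately have "ennreal (N I) \<le> (\<integral>\<^sup>+x. N (f x) \<partial>M) + ennreal L * 0"
    by (intro LIMSEQ_le[of "\<lambda>i. ennreal (N (Bochner_Integration.simple_bochner_integral M (s i)))"]) auto
  then show ?thesis by simp
qed

section \<open>Linearity, uniqueness and existence of the integral\<close>

lemma has_banach_bochner_integral_cong_AE:
  assumes "has_banach_bochner_integral M f I" "AE x in M. f x = g x"
  shows "has_banach_bochner_integral M g I"
proof -
  have "(\<integral>\<^sup>+ x. ennreal (norm (f x - s x)) \<partial>M) = (\<integral>\<^sup>+ x. ennreal (norm (g x - s x)) \<partial>M)" for s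
    using assms(2) by (intro nn_integral_cong_AE, eventually_elim) simp
  then show ?thesis
    using assms bochner_measurable_cong_AE[of M f g] unfolding has_banach_bochner_integral_def by auto
qed

lemma tendsto_0_ennreal_le:
  fixes f g :: "'b \<Rightarrow> ennreal"
  assumes "\<And>x. f x \<le> g x" "(g \<longlongrightarrow> 0) F"
  shows "(f \<longlongrightarrow> 0) F"
  by (rule tendsto_sandwich[of "\<lambda>_. 0" f F g]) (use assms in simp_all)

lemma has_banach_bochner_integral_bounded_linear:
  assumes A: "bounded_linear A" and f: "has_banach_bochner_integral M f I"
  shows "has_banach_bochner_integral M (\<lambda>x. A (f x)) (A I)"
proof -
  interpret A: bounded_linear A by (rule A)
  from f obtain s where m: "bochner_measurable M f"
    and s: "\<And>i::nat. Bochner_Integration.simple_bochner_integrable M (s i)"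
      "(\<lambda>i. \<integral>\<^sup>+ x. ennreal (norm (f x - s i x)) \<partial>M) \<longlonglongrightarrow> 0"
      "(\<lambda>i. Bochner_Integration.simple_bochner_integral M (s i)) \<longlonglongrightarrow> I"
    by (rule has_banach_bochner_integralE) blast
  obtain K where K: "0 < K" "\<And>x. norm (A x) \<le> norm x * K" using A.pos_bounded by blast
  show ?thesis unfolding has_banach_bochner_integral_def
  proof (intro conjI exI allI)
    show "bochner_measurable M (\<lambda>x. A (f x))"
      by (rule bochner_measurable_compose[OF m]) (rule A.continuous_on[OF continuous_on_id])
    show "Bochner_Integration.simple_bochner_integrable M (\<lambda>x. A (s i x))" for i
      using simple_bochner_integrable_compose2[of "\<lambda>a b. A a", OF A.zero s(1) s(1)] .
    have le: "(\<integral>\<^sup>+ x. ennreal (norm (A (f x) - A (s i x))) \<partial>M)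
        \<le> ennreal K * (\<integral>\<^sup>+ x. ennreal (norm (f x - s i x)) \<partial>M)" for i
    proof -
      have "(\<integral>\<^sup>+ x. ennreal (norm (A (f x) - A (s i x))) \<partial>M)
        \<le> (\<integral>\<^sup>+ x. ennreal (0 + K * norm (f x - s i x)) \<partial>M)"
        using K(2) by (intro nn_integral_mono ennreal_leI) (metis A.diff add_0 mult.commute)
      also have "\<dots> = (\<integral>\<^sup>+x. ennreal 0 \<partial>M) + ennreal K * (\<integral>\<^sup>+ x. ennreal (norm (f x - s i x)) \<partial>M)"
        by (intro nn_integral_linear_bochner_measurable bochner_measurable_norm bochner_measurable_diff m
            bochner_measurable_simple bochner_measurable_simple_bochner_integrable s(1))
          (use K in simp_all)
      finally show ?thesis by simp
    qed
    have "(\<lambda>i. ennreal K * (\<integral>\<^sup>+ x. ennreal (norm (f x - s i x)) \<partial>M)) \<longlonglongrightarrow> ennreal K * 0"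
      by (intro ennreal_tendsto_cmult s(2)) simp
    with le show "(\<lambda>i. \<integral>\<^sup>+ x. ennreal (norm (A (f x) - A (s i x))) \<partial>M) \<longlonglongrightarrow> 0"
      unfolding mult_zero_right by (rule tendsto_0_ennreal_le)
    show "(\<lambda>i. Bochner_Integration.simple_bochner_integral M (\<lambda>x. A (s i x))) \<longlonglongrightarrow> A I"
      unfolding simple_bochner_integral_linear[OF A.linear_axioms s(1)] by (rule A.tendsto[OF s(3)])
  qed
qed

lemma has_banach_bochner_integral_diff:
  assumes f: "has_banach_bochner_integral M f I" and g: "has_banach_bochner_integral M g J"
  shows "has_banach_bochner_integral M (\<lambda>x. f x - g x) (I - J)"
proof -
  from f obtain s where mf: "bochner_measurable M f"
    and s: "\<And>i::nat. Bochner_Integration.simple_bochner_integrable M (s i)"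
      "(\<lambda>i. \<integral>\<^sup>+ x. ennreal (norm (f x - s i x)) \<partial>M) \<longlonglongrightarrow> 0"
      "(\<lambda>i. Bochner_Integration.simple_bochner_integral M (s i)) \<longlonglongrightarrow> I"
    by (rule has_banach_bochner_integralE) blast
  from g obtain t where mg: "bochner_measurable M g"
    and t: "\<And>i::nat. Bochner_Integration.simple_bochner_integrable M (t i)"
      "(\<lambda>i. \<integral>\<^sup>+ x. ennreal (norm (g x - t i x)) \<partial>M) \<longlonglongrightarrow> 0"
      "(\<lambda>i. Bochner_Integration.simple_bochner_integral M (t i)) \<longlonglongrightarrow> J"
    by (rule has_banach_bochner_integralE) blast
  show ?thesis unfolding has_banach_bochner_integral_def
  proof (intro conjI exI allI)
    show "bochner_measurable M (\<lambda>x. f x - g x)" by (rule bochner_measurable_diff[OF mf mg])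
    show "Bochner_Integration.simple_bochner_integrable M (\<lambda>x. s i x - t i x)" for i
      using simple_bochner_integrable_compose2[of "(-)" M "s i" "t i"] s(1) t(1) by simp
    have le: "(\<integral>\<^sup>+ x. ennreal (norm (f x - g x - (s i x - t i x))) \<partial>M)
        \<le> (\<integral>\<^sup>+ x. ennreal (norm (f x - s i x)) \<partial>M) + (\<integral>\<^sup>+ x. ennreal (norm (g x - t i x)) \<partial>M)" for i
    proof -
      have "(\<integral>\<^sup>+ x. ennreal (norm (f x - g x - (s i x - t i x))) \<partial>M)
        \<le> (\<integral>\<^sup>+ x. ennreal (norm (f x - s i x) + 1 * norm (g x - t i x)) \<partial>M)"
      proof (intro nn_integral_mono ennreal_leI)
        fix x
        have eq: "f x - g x - (s i x - t i x) = (f x - s i x) - (g x - t i x)" by simp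
        show "norm (f x - g x - (s i x - t i x)) \<le> norm (f x - s i x) + 1 * norm (g x - t i x)"
          unfolding eq mult_1 by (rule norm_triangle_ineq4)
      qed
      also have "\<dots> = (\<integral>\<^sup>+x. ennreal (norm (f x - s i x)) \<partial>M) + ennreal 1 * (\<integral>\<^sup>+ x. ennreal (norm (g x - t i x)) \<partial>M)"
        by (intro nn_integral_linear_bochner_measurable bochner_measurable_norm bochner_measurable_diff mf mg
            bochner_measurable_simple_bochner_integrable s(1) t(1)) simp_all
      finally show ?thesis by simp
    qed
    show "(\<lambda>i. \<integral>\<^sup>+ x. ennreal (norm (f x - g x - (s i x - t i x))) \<partial>M) \<longlonglongrightarrow> 0"
      by (rule tendsto_0_ennreal_le[OF le]) (use tendsto_add[OF s(2) t(2)] in simp)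
    show "(\<lambda>i. Bochner_Integration.simple_bochner_integral M (\<lambda>x. s i x - t i x)) \<longlonglongrightarrow> I - J"
      unfolding simple_bochner_integral_diff[OF s(1) t(1)] by (rule tendsto_diff[OF s(3) t(3)])
  qed
qed

text \<open>The difference of two integrals is an integral of the zero function, so the norm
  inequality bounds it by 0. This makes the definite description in
  \<open>banach_bochner_integral\<close> meaningful.\<close>

lemma has_banach_bochner_integral_unique:
  assumes "has_banach_bochner_integral M f I" "has_banach_bochner_integral M f J"
  shows "I = J"
proof -
  have "ennreal (norm (I - J)) \<le> (\<integral>\<^sup>+x. norm (f x - f x) \<partial>M)"
    using has_banach_bochner_integral_is_norm_le[OF is_norm_norm _ has_banach_bochner_integral_diff[OF assms], of 1]
    by simp
  then show ?thesis by simp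
qed

lemma banach_bochner_integral_eq:
  "has_banach_bochner_integral M f I \<Longrightarrow> banach_bochner_integral M f = I"
  unfolding banach_bochner_integral_def using has_banach_bochner_integral_unique by blast

text \<open>The given approximants converge only pointwise. Truncation makes them dominated by a
  multiple of \<open>norm (f x)\<close>, hence convergent in L1; their integrals are then Cauchy,
  and completeness of the space yields the limit.\<close>

lemma has_banach_bochner_integral_exists:
  fixes f :: "'b \<Rightarrow> 'a::banach"
  assumes m: "bochner_measurable M f" and fin: "(\<integral>\<^sup>+x. norm (f x) \<partial>M) < \<infinity>"
  shows "\<exists>I. has_banach_bochner_integral M f I"
proof -
  from m obtain s where s: "\<And>i::nat. simple_function M (s i)" "AE x in M. (\<lambda>i. s i x) \<longlonglongrightarrow> f x"
    by (rule bochner_measurableE) blast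
  obtain g where [measurable]: "g \<in> borel_measurable M" and g: "AE x in M. norm (f x) = g x"
    using bochner_measurable_real_borel[OF bochner_measurable_norm[OF m]] .
  have sm[measurable]: "(\<lambda>x. norm (s i x)) \<in> borel_measurable M" for i
    by (rule borel_measurable_simple_function[OF simple_function_compose1[OF s(1)]])
  \<comment> \<open>The Borel representative \<open>g\<close> makes the truncation set measurable.
    Where \<open>f x\<close> is nonzero, the factor 2 leaves room for the truncation to be
    eventually inactive; where \<open>f x = 0\<close>, it forces \<open>t i x = 0\<close>.\<close>
  define t where "t i x = (if norm (s i x) \<le> 2 * g x then s i x else 0)" for i x
  have t: "simple_function M (t i)" for i
  proof -
    have "{x \<in> space M. norm (s i x) \<le> 2 * g x} \<in> sets M" by measurable
    then show ?thesis unfolding t_def by (rule simple_function_If[OF s(1) simple_function_const])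
  qed
  have tb: "AE x in M. norm (t i x) \<le> 2 * norm (f x)" for i
    using g
  proof eventually_elim
    case (elim x)
    then show ?case using norm_ge_zero[of "f x"] by (simp add: t_def)
  qed
  have tl: "AE x in M. (\<lambda>i. t i x) \<longlonglongrightarrow> f x"
    using s(2) g
  proof eventually_elim
    case (elim x)
    show ?case
    proof (cases "f x = 0")
      case True
      then have "t i x = 0" for i using elim(2) by (simp add: t_def)
      then show ?thesis using True by simp
    next
      case False
      have "\<forall>\<^sub>F i in sequentially. norm (s i x) < 2 * norm (f x)"
        using False by (intro order_tendstoD(2)[OF tendsto_norm[OF elim(1)]]) simp
      then have "\<forall>\<^sub>F i in sequentially. s i x = t i x"
        by eventually_elim (simp add: t_def elim(2))
      with elim(1) show ?thesis by (rule Lim_transform_eventually)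
    qed
  qed
  \<comment> \<open>The summand 0 only matches the shape of the linearity lemma. It is used with
    \<open>c = 2\<close> to bound the truncations and with \<open>c = 3\<close> to bound their
    distance to \<open>f\<close>.\<close>
  have fin3: "(\<integral>\<^sup>+x. ennreal (0 + c * norm (f x)) \<partial>M) < \<infinity>" if "0 \<le> c" for c
    using nn_integral_linear_bochner_measurable[OF bochner_measurable_simple bochner_measurable_norm[OF m], of "\<lambda>_. 0" c]
      fin that by (simp add: ennreal_mult_less_top)
  have ti: "Bochner_Integration.simple_bochner_integrable M (t i)" for i
  proof (rule simple_bochner_integrableI_bounded[OF t])
    have "(\<integral>\<^sup>+x. norm (t i x) \<partial>M) \<le> (\<integral>\<^sup>+x. ennreal (0 + 2 * norm (f x)) \<partial>M)"
      using tb[of i] by (intro nn_integral_mono_AE, eventually_elim) (simp add: ennreal_leI)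
    then show "(\<integral>\<^sup>+x. norm (t i x) \<partial>M) < \<infinity>" using fin3[of 2] by (simp add: order_le_less_trans)
  qed
  have lim: "(\<lambda>i. \<integral>\<^sup>+x. norm (f x - t i x) \<partial>M) \<longlonglongrightarrow> 0"
  proof (rule nn_integral_dominated_convergence_bochner_measurable[where w="\<lambda>x. 0 + 3 * norm (f x)"])
    show "bochner_measurable M (\<lambda>x. norm (f x - t i x))" for i
      by (intro bochner_measurable_norm bochner_measurable_diff m bochner_measurable_simple t)
    show "bochner_measurable M (\<lambda>x. 0 + 3 * norm (f x))"
      using bochner_measurable_scaleR[OF _ bochner_measurable_norm[OF m], of "\<lambda>_. 3"] by simp
    show "AE x in M. norm (f x - t i x) \<le> 0 + 3 * norm (f x)" for i
      using tb[of i] by eventually_elim (smt (verit) norm_triangle_ineq4)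
    show "AE x in M. (\<lambda>i. norm (f x - t i x)) \<longlonglongrightarrow> 0"
      using tl by eventually_elim (auto intro!: tendsto_eq_intros)
  qed (use fin3[of 3] in simp)
  have tm: "bochner_measurable M (t i)" for i by (intro bochner_measurable_simple t)
  have diff: "ennreal (norm (Bochner_Integration.simple_bochner_integral M (t i) - Bochner_Integration.simple_bochner_integral M (t j)))
      \<le> (\<integral>\<^sup>+x. norm (f x - t i x) \<partial>M) + (\<integral>\<^sup>+x. norm (f x - t j x) \<partial>M)" for i j
  proof -
    have int: "Bochner_Integration.simple_bochner_integrable M (\<lambda>x. t i x - t j x)"
      using simple_bochner_integrable_compose2[of "(-)" M "t i" "t j"] ti by simp
    have "ennreal (norm (Bochner_Integration.simple_bochner_integral M (t i) - Bochner_Integration.simple_bochner_integral M (t j)))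
       \<le> (\<integral>\<^sup>+x. norm (t i x - t j x) \<partial>M)"
      using simple_bochner_integral_is_norm_le[OF is_norm_norm int] simple_bochner_integral_diff[OF ti ti] by simp
    also have "\<dots> \<le> (\<integral>\<^sup>+x. ennreal (norm (f x - t i x) + 1 * norm (f x - t j x)) \<partial>M)"
    proof (intro nn_integral_mono ennreal_leI)
      fix x
      show "norm (t i x - t j x) \<le> norm (f x - t i x) + 1 * norm (f x - t j x)"
        using norm_triangle_ineq4[of "f x - t j x" "f x - t i x"] by simp
    qed
    also have "\<dots> = (\<integral>\<^sup>+x. norm (f x - t i x) \<partial>M) + ennreal 1 * (\<integral>\<^sup>+x. norm (f x - t j x) \<partial>M)"
      by (intro nn_integral_linear_bochner_measurable bochner_measurable_norm bochner_measurable_diff m tm) auto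
    finally show ?thesis by simp
  qed
  have "Cauchy (\<lambda>i. Bochner_Integration.simple_bochner_integral M (t i))"
  proof (rule metric_CauchyI)
    fix e :: real assume e: "0 < e"
    then have "\<forall>\<^sub>F i in sequentially. (\<integral>\<^sup>+x. norm (f x - t i x) \<partial>M) < ennreal (e / 2)"
      by (intro order_tendstoD(2)[OF lim]) simp
    then obtain n where n: "\<And>i. n \<le> i \<Longrightarrow> (\<integral>\<^sup>+x. norm (f x - t i x) \<partial>M) < ennreal (e / 2)"
      by (auto simp: eventually_sequentially)
    have "dist (Bochner_Integration.simple_bochner_integral M (t i)) (Bochner_Integration.simple_bochner_integral M (t j)) < e" if "n \<le> i" "n \<le> j" for i j
    proof -
      have "ennreal (norm (Bochner_Integration.simple_bochner_integral M (t i) - Bochner_Integration.simple_bochner_integral M (t j))) < ennreal (e/2) + ennreal (e/2)"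
        using diff[of i j] n[OF that(1)] n[OF that(2)] by (meson add_strict_mono order_le_less_trans)
      also have "\<dots> = ennreal e" using e by (simp flip: ennreal_plus)
      finally show ?thesis by (simp add: dist_norm ennreal_less_iff)
    qed
    then show "\<exists>M'. \<forall>i\<ge>M'. \<forall>j\<ge>M'. dist (Bochner_Integration.simple_bochner_integral M (t i)) (Bochner_Integration.simple_bochner_integral M (t j)) < e"
      by blast
  qed
  then obtain I where "(\<lambda>i. Bochner_Integration.simple_bochner_integral M (t i)) \<longlonglongrightarrow> I"
    using Cauchy_convergent convergent_def by blast
  with m ti lim show ?thesis by (blast intro: has_banach_bochner_integralI)
qed

section \<open>Restriction to measurable subsets and dominated convergence\<close>

lemma has_banach_bochner_integral_restrict_spaceD:
  assumes \<Omega>: "\<Omega> \<inter> space M \<in> sets M" and f: "has_banach_bochner_integral (restrict_space M \<Omega>) f I"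
  shows "has_banach_bochner_integral M (\<lambda>x. indicator \<Omega> x *\<^sub>R f x) I"
proof -
  from f obtain s where m: "bochner_measurable (restrict_space M \<Omega>) f"
    and s: "\<And>i::nat. Bochner_Integration.simple_bochner_integrable (restrict_space M \<Omega>) (s i)"
      "(\<lambda>i. \<integral>\<^sup>+ x. ennreal (norm (f x - s i x)) \<partial>restrict_space M \<Omega>) \<longlonglongrightarrow> 0"
      "(\<lambda>i. Bochner_Integration.simple_bochner_integral (restrict_space M \<Omega>) (s i)) \<longlonglongrightarrow> I"
    by (rule has_banach_bochner_integralE) blast
  have eq: "ennreal (norm (f x - s i x)) * indicator \<Omega> x
      = ennreal (norm (indicator \<Omega> x *\<^sub>R f x - indicator \<Omega> x *\<^sub>R s i x))" for i x
    by (auto simp: indicator_def)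
  show ?thesis
  proof (rule has_banach_bochner_integralI)
    show "bochner_measurable M (\<lambda>x. indicator \<Omega> x *\<^sub>R f x)"
      using m by (simp add: bochner_measurable_restrict_space[OF \<Omega>])
    show "Bochner_Integration.simple_bochner_integrable M (\<lambda>x. indicator \<Omega> x *\<^sub>R s i x)" for i
      using s(1) by (simp add: simple_bochner_integrable_restrict_space[OF \<Omega>])
  qed (use s(2)[unfolded nn_integral_restrict_space[OF \<Omega>] eq]
      s(3)[unfolded simple_bochner_integral_restrict_space[OF \<Omega> s(1)]] in simp_all)
qed

text \<open>Approximants of the extended function need not vanish off \<open>\<Omega>\<close>.
  Instead, absolute integrability gives some integral over the subset, and extension by zero
  together with uniqueness identifies its value.\<close>

lemma has_banach_bochner_integral_restrict_spaceI:
  fixes f :: "'b \<Rightarrow> 'a::banach"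
  assumes \<Omega>: "\<Omega> \<inter> space M \<in> sets M" and f: "has_banach_bochner_integral M (\<lambda>x. indicator \<Omega> x *\<^sub>R f x) I"
    and fin: "(\<integral>\<^sup>+x. norm (indicator \<Omega> x *\<^sub>R f x) \<partial>M) < \<infinity>"
  shows "has_banach_bochner_integral (restrict_space M \<Omega>) f I"
proof -
  have eq: "ennreal (norm (f x)) * indicator \<Omega> x = ennreal (norm (indicator \<Omega> x *\<^sub>R f x))" for x
    by (auto simp: indicator_def)
  have "\<exists>J. has_banach_bochner_integral (restrict_space M \<Omega>) f J"
    using f fin unfolding has_banach_bochner_integral_def[of M]
    by (intro has_banach_bochner_integral_exists)
      (simp_all add: bochner_measurable_restrict_space[OF \<Omega>] nn_integral_restrict_space[OF \<Omega>] eq)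
  then obtain J where J: "has_banach_bochner_integral (restrict_space M \<Omega>) f J" ..
  have "J = I"
    by (rule has_banach_bochner_integral_unique[OF has_banach_bochner_integral_restrict_spaceD[OF \<Omega> J] f])
  with J show ?thesis by simp
qed

text \<open>The norm inequality for \<open>f i - g\<close> reduces the claim to scalar dominated
  convergence.\<close>

lemma has_banach_bochner_integral_dominated_convergence:
  assumes f: "\<And>i::nat. has_banach_bochner_integral M (f i) (I i)" and g: "has_banach_bochner_integral M g J"
    and w: "bochner_measurable M w" "(\<integral>\<^sup>+x. ennreal (w x) \<partial>M) < \<infinity>"
    and dom: "\<And>i. AE x in M. norm (f i x - g x) \<le> w x"
    and lim: "AE x in M. (\<lambda>i. f i x) \<longlonglongrightarrow> g x"
  shows "I \<longlonglongrightarrow> J"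
proof -
  have "(\<lambda>i. \<integral>\<^sup>+x. norm (f i x - g x) \<partial>M) \<longlonglongrightarrow> 0"
  proof (rule nn_integral_dominated_convergence_bochner_measurable[OF _ w(1) dom w(2)])
    show "bochner_measurable M (\<lambda>x. norm (f i x - g x))" for i
      using f g unfolding has_banach_bochner_integral_def
      by (intro bochner_measurable_norm bochner_measurable_diff) auto
    show "AE x in M. (\<lambda>i. norm (f i x - g x)) \<longlonglongrightarrow> 0"
      using lim by eventually_elim (auto intro!: tendsto_eq_intros)
  qed
  then have "(\<lambda>i. ennreal (norm (I i - J))) \<longlonglongrightarrow> ennreal 0"
    unfolding ennreal_0
  proof (rule tendsto_0_ennreal_le[rotated])
    fix i
    show "ennreal (norm (I i - J)) \<le> (\<integral>\<^sup>+x. norm (f i x - g x) \<partial>M)"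
      using has_banach_bochner_integral_is_norm_le[OF is_norm_norm _ has_banach_bochner_integral_diff[OF f g], of 1]
      by simp
  qed
  then have "(\<lambda>i. norm (I i - J)) \<longlonglongrightarrow> 0"
    by (subst (asm) tendsto_ennreal_iff) simp_all
  then show ?thesis
    by (rule LIM_zero_cancel[OF tendsto_norm_zero_cancel])
qed

section \<open>Measurability of a time-dependent Lipschitz map applied to a measurable
  function\<close>

text \<open>First the second variable is moved at cost \<open>K\<close>, which converges along the
  sequence and so stays bounded; then the first variable is moved with the second one fixed at its
  limit.\<close>

lemma continuous_on_Pair_Lipschitz:
  fixes \<phi> :: "'c::metric_space \<Rightarrow> 'a::metric_space \<Rightarrow> 'b::metric_space"
  assumes cont: "\<And>v. continuous_on UNIV (\<lambda>\<tau>. \<phi> \<tau> v)" and K: "continuous_on UNIV K"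
    and lip: "\<And>\<tau> v w. dist (\<phi> \<tau> v) (\<phi> \<tau> w) \<le> K \<tau> * dist v w"
  shows "continuous_on UNIV (\<lambda>p. \<phi> (fst p) (snd p))"
  unfolding continuous_on_sequentially
proof (intro allI ballI impI, elim conjE)
  fix u :: "nat \<Rightarrow> 'c \<times> 'a" and a assume "u \<longlonglongrightarrow> a"
  then have fst: "(\<lambda>n. fst (u n)) \<longlonglongrightarrow> fst a" and snd: "(\<lambda>n. snd (u n)) \<longlonglongrightarrow> snd a"
    by (auto intro: tendsto_fst tendsto_snd)
  have "(\<lambda>n. K (fst (u n)) * dist (snd (u n)) (snd a) + dist (\<phi> (fst (u n)) (snd a)) (\<phi> (fst a) (snd a)))
     \<longlonglongrightarrow> K (fst a) * dist (snd a) (snd a) + dist (\<phi> (fst a) (snd a)) (\<phi> (fst a) (snd a))"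
    by (intro tendsto_intros snd continuous_on_tendsto_compose[OF K fst]
        continuous_on_tendsto_compose[OF cont fst]) auto
  then have lim: "(\<lambda>n. K (fst (u n)) * dist (snd (u n)) (snd a) + dist (\<phi> (fst (u n)) (snd a)) (\<phi> (fst a) (snd a)))
     \<longlonglongrightarrow> 0" by simp
  have "dist (\<phi> (fst (u n)) (snd (u n))) (\<phi> (fst a) (snd a))
      \<le> K (fst (u n)) * dist (snd (u n)) (snd a) + dist (\<phi> (fst (u n)) (snd a)) (\<phi> (fst a) (snd a))" for n
    using lip[of "fst (u n)" "snd (u n)" "snd a"] dist_triangle[of "\<phi> (fst (u n)) (snd (u n))" "\<phi> (fst a) (snd a)" "\<phi> (fst (u n)) (snd a)"]
    by linarith
  then have "(\<lambda>n. dist (\<phi> (fst (u n)) (snd (u n))) (\<phi> (fst a) (snd a))) \<longlonglongrightarrow> 0"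
    by (intro tendsto_sandwich[of "\<lambda>_. 0", OF _ _ tendsto_const lim]) simp_all
  then show "((\<lambda>p. \<phi> (fst p) (snd p)) \<circ> u) \<longlonglongrightarrow> \<phi> (fst a) (snd a)"
    unfolding comp_def
    by (rule tendsto_dist_iff[THEN iffD2])
qed

lemma bochner_measurable_lebesgue_Lipschitz:
  fixes \<phi> :: "real \<Rightarrow> 'a::real_normed_vector \<Rightarrow> 'b::real_normed_vector"
  assumes "\<And>v. continuous_on UNIV (\<lambda>\<tau>. \<phi> \<tau> v)" "continuous_on UNIV K"
    and "\<And>\<tau> v w. norm (\<phi> \<tau> v - \<phi> \<tau> w) \<le> K \<tau> * norm (v - w)"
    and y: "bochner_measurable lebesgue y"
  shows "bochner_measurable lebesgue (\<lambda>\<tau>. \<phi> \<tau> (y \<tau>))"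
proof -
  have id: "bochner_measurable lebesgue (\<lambda>\<tau>::real. \<tau>)"
    by (intro borel_measurable_imp_bochner_measurable measurable_completion) simp
  have "continuous_on UNIV (\<lambda>p. \<phi> (fst p) (snd p))"
    using assms(1-3) by (intro continuous_on_Pair_Lipschitz) (auto simp: dist_norm)
  from bochner_measurable_compose[OF bochner_measurable_Pair[OF id y] this] show ?thesis by simp
qed

section \<open>Dichotomies\<close>

text \<open>\<open>\<kappa>\<close> stands for the bound C exp(\<epsilon> \<rho>(t)); its continuity
  in time supplies continuous Lipschitz constants for the kernels. Fixing \<open>l\<close> and
  \<open>D\<close> lets all estimates share the same dichotomy constants.\<close>

locale dichotomic_family =
  fixes T :: "real \<Rightarrow> real \<Rightarrow> 'a::banach \<Rightarrow>\<^sub>L 'a"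
    and P :: "real \<Rightarrow> 'a \<Rightarrow>\<^sub>L 'a"
    and N :: "real \<Rightarrow> 'a \<Rightarrow> real"
    and \<rho> \<kappa> :: "real \<Rightarrow> real"
    and l D :: real
  assumes evolution: "evolution_family T"
    and rho_mono: "mono_on {0..} \<rho>"
    and is_norm: "0 \<le> t \<Longrightarrow> is_norm (N t)"
    and continuous_N: "continuous_on {0..} (\<lambda>t. N t x)"
    and continuous_kappa: "continuous_on {0..} \<kappa>"
    and norm_le_N: "0 \<le> t \<Longrightarrow> norm x \<le> N t x"
    and N_le_kappa: "0 \<le> t \<Longrightarrow> N t x \<le> \<kappa> t * norm x"
    and projection: "0 \<le> t \<Longrightarrow> P t o\<^sub>L P t = P t"
    and intertwining: "0 \<le> s \<Longrightarrow> s \<le> t \<Longrightarrow> T t s o\<^sub>L P s = P t o\<^sub>L T t s"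
    and kernel_bij: "0 \<le> s \<Longrightarrow> s \<le> t \<Longrightarrow>
          bij_betw (blinfun_apply (T t s)) (blinfun_ker (P s)) (blinfun_ker (P t))"
    and l_pos: "0 < l" and D_pos: "0 < D"
    and stable: "0 \<le> s \<Longrightarrow> s \<le> t \<Longrightarrow> N t (T t s (P s x)) \<le> D * exp (- l * (\<rho> t - \<rho> s)) * N s x"
    and unstable: "0 \<le> t \<Longrightarrow> t \<le> s \<Longrightarrow>
          N t (backward_evolution T P t s (x - P s x)) \<le> D * exp (- l * (\<rho> s - \<rho> t)) * N s x"
begin

lemma T_refl: "0 \<le> t \<Longrightarrow> T t t v = v"
  using evolution unfolding evolution_family_def by simp

lemma T_trans: "0 \<le> r \<Longrightarrow> r \<le> s \<Longrightarrow> s \<le> t \<Longrightarrow> T t s (T s r v) = T t r v"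
  using evolution unfolding evolution_family_def by (metis blinfun_apply_blinfun_compose)

lemma continuous_T_left: "0 \<le> s \<Longrightarrow> continuous_on {s..} (\<lambda>t. T t s v)"
  using evolution unfolding evolution_family_def by simp

lemma continuous_T_right: "0 \<le> s \<Longrightarrow> continuous_on {0..s} (\<lambda>t. T s t v)"
  using evolution unfolding evolution_family_def by simp

lemma P_idem: "0 \<le> t \<Longrightarrow> P t (P t v) = P t v"
  using projection by (metis blinfun_apply_blinfun_compose)

lemma T_P: "0 \<le> s \<Longrightarrow> s \<le> t \<Longrightarrow> T t s (P s v) = P t (T t s v)"
  using intertwining by (metis blinfun_apply_blinfun_compose)

lemma N_nonneg: "0 \<le> t \<Longrightarrow> 0 \<le> N t x"
  using is_norm_nonneg[OF is_norm] .

lemma backward_evolution_T: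
  assumes "0 \<le> t" "t \<le> s" "P t v = 0"
  shows "backward_evolution T P t s (T s t v) = v"
  unfolding backward_evolution_def
  using kernel_bij[OF assms(1,2)] assms(3)
  by (intro inv_into_f_f) (auto simp: bij_betw_def blinfun_ker_def)

section \<open>Unstable components transported back to time 0\<close>

definition G :: "real \<Rightarrow> 'a \<Rightarrow> 'a"
  where "G s v = backward_evolution T P 0 s (v - P s v)"

lemma
  assumes "0 \<le> s"
  shows P_G: "P 0 (G s v) = 0" and T_G: "T s 0 (G s v) = v - P s v"
proof -
  have "v - P s v \<in> blinfun_ker (P s)"
    using P_idem[OF assms] by (simp add: blinfun_ker_def blinfun.diff_right)
  then have *: "v - P s v \<in> blinfun_apply (T s 0) ` blinfun_ker (P 0)"
    using kernel_bij[of 0 s] assms by (simp add: bij_betw_def)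
  show "T s 0 (G s v) = v - P s v"
    unfolding G_def backward_evolution_def by (rule f_inv_into_f[OF *])
  show "P 0 (G s v) = 0"
    using inv_into_into[OF *] unfolding G_def backward_evolution_def by (simp add: blinfun_ker_def)
qed

text \<open>Injectivity of \<open>T s 0\<close> on the kernel of \<open>P 0\<close> makes
  \<open>P_G\<close> and \<open>T_G\<close> characteristic. Algebraic identities for
  \<open>G\<close> are checked through this characterization rather than through the
  inverse.\<close>

lemma G_unique:
  assumes "0 \<le> s" "P 0 z = 0" "T s 0 z = v - P s v"
  shows "G s v = z"
  using backward_evolution_T[of 0 s z] assms unfolding G_def by simp

lemma G_T:
  assumes "0 \<le> s" "s \<le> t"
  shows "G t (T t s v) = G s v"
proof (rule G_unique)
  show "T t 0 (G s v) = T t s v - P t (T t s v)"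
    using T_trans[of 0 s t "G s v"] T_G[of s v] T_P[of s t v] assms by (simp add: blinfun.diff_right)
qed (use assms P_G in simp_all)

lemma G_diff: "0 \<le> s \<Longrightarrow> G s (v - w) = G s v - G s w"
  by (rule G_unique) (simp_all add: P_G T_G blinfun.diff_right)

lemma G_zero: "0 \<le> s \<Longrightarrow> G s 0 = 0"
  using G_diff[of s 0 0] by simp

text \<open>For an integrable right-hand side a bounded kernel suffices, so the weights are
  estimated by 1 here; their decay enters in the uniqueness argument.\<close>

lemma exp_weight_le_1:
  assumes "0 \<le> s" "s \<le> t"
  shows "exp (- l * (\<rho> t - \<rho> s)) \<le> 1"
  using mono_onD[OF rho_mono, of s t] assms l_pos by simp

text \<open>Since \<open>T s 0 (G s v) = v - P s v\<close>, the difference is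
  \<open>T t s (P s v)\<close>, to which the forward estimate applies.\<close>

lemma stable_le:
  assumes "0 \<le> s" "s \<le> t"
  shows "N t (T t s v - T t 0 (G s v)) \<le> D * N s v"
proof -
  have "T t s v - T t 0 (G s v) = T t s (P s v)"
    using T_trans[of 0 s t "G s v"] T_G[of s v] assms by (simp add: blinfun.diff_right algebra_simps)
  moreover have "N t (T t s (P s v)) \<le> D * 1 * N s v"
    using exp_weight_le_1[OF assms] N_nonneg[of s v] D_pos assms
    by (intro order_trans[OF stable[OF assms]] mult_mono) auto
  ultimately show ?thesis by simp
qed

text \<open>The vector \<open>T t 0 (G s v)\<close> lies in the kernel of \<open>P t\<close> and is
  carried by \<open>T s t\<close> to \<open>v - P s v\<close>; hence it is the backward image to
  which the second estimate applies.\<close>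

lemma unstable_le:
  assumes "0 \<le> t" "t \<le> s"
  shows "N t (T t 0 (G s v)) \<le> D * N s v"
proof -
  have "T s t (T t 0 (G s v)) = v - P s v"
    using T_trans[of 0 t s "G s v"] T_G[of s v] assms by simp
  moreover have "P t (T t 0 (G s v)) = 0"
    using T_P[of 0 t "G s v"] P_G[of s v] assms by (simp add: blinfun.zero_right)
  ultimately have "T t 0 (G s v) = backward_evolution T P t s (v - P s v)"
    using backward_evolution_T[OF assms] by metis
  moreover have "N t (backward_evolution T P t s (v - P s v)) \<le> D * 1 * N s v"
    using exp_weight_le_1[OF assms] N_nonneg[of s v] D_pos assms
    by (intro order_trans[OF unstable[OF assms]] mult_mono) auto
  ultimately show ?thesis by simp
qed

lemma norm_G_le:
  assumes "0 \<le> s"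
  shows "norm (G s v) \<le> D * \<kappa> s * norm v"
proof -
  have "norm (G s v) \<le> N 0 (T 0 0 (G s v))"
    using norm_le_N[of 0 "G s v"] T_refl by simp
  also have "\<dots> \<le> D * N s v" using unstable_le[of 0 s v] assms by simp
  also have "\<dots> \<le> D * (\<kappa> s * norm v)" using N_le_kappa[OF assms] D_pos by simp
  finally show ?thesis by simp
qed

text \<open>Splitting into the stable part and \<open>T t 0 (G s v)\<close> yields, for fixed
  \<open>t\<close>, a bound continuous in \<open>s\<close>, as the superposition lemma for
  measurability requires.\<close>

lemma norm_T_le:
  assumes "0 \<le> s" "s \<le> t"
  shows "norm (T t s v) \<le> (1 + norm (T t 0)) * (D * \<kappa> s) * norm v"
proof -
  have "norm (T t s v) \<le> norm (T t s v - T t 0 (G s v)) + norm (T t 0 (G s v))"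
    by (metis diff_add_cancel norm_triangle_ineq)
  also have "\<dots> \<le> D * (\<kappa> s * norm v) + norm (T t 0) * (D * \<kappa> s * norm v)"
  proof (rule add_mono)
    have "norm (T t s v - T t 0 (G s v)) \<le> D * N s v"
      using norm_le_N[of t "T t s v - T t 0 (G s v)"] stable_le[OF assms, of v] assms by simp
    also have "\<dots> \<le> D * (\<kappa> s * norm v)" using N_le_kappa[OF assms(1)] D_pos by simp
    finally show "norm (T t s v - T t 0 (G s v)) \<le> D * (\<kappa> s * norm v)" .
    show "norm (T t 0 (G s v)) \<le> norm (T t 0) * (D * \<kappa> s * norm v)"
      by (rule order_trans[OF norm_blinfun mult_left_mono[OF norm_G_le[OF assms(1)]]]) simp
  qed
  finally show ?thesis by (simp add: algebra_simps)
qed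

lemma continuous_G: "continuous_on {0..} (\<lambda>s. G s v)"
proof -
  have "continuous (at s within {0..}) (\<lambda>s. G s v)" if "0 \<le> s" for s
  proof -
    \<comment> \<open>Any time beyond \<open>s\<close> would do: on \<open>[0,t]\<close>, which is a
      relative neighbourhood of \<open>s\<close>, \<open>G r v\<close> equals
      \<open>G t (T t r v)\<close>, a fixed Lipschitz map applied to a continuous curve.\<close>
    define t where "t = s + 1"
    have "continuous_on {0..t} (\<lambda>r. G t (T t r v))"
    proof -
      have "norm (G t a - G t b) \<le> \<bar>D * \<kappa> t\<bar> * norm (a - b)" for a b
        using norm_G_le[of t "a - b"] G_diff[of t a b] that
          mult_right_mono[OF abs_ge_self, of "norm (a - b)" "D * \<kappa> t"] by (simp add: t_def)
      then have "\<bar>D * \<kappa> t\<bar>-lipschitz_on UNIV (G t)"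
        by (intro lipschitz_onI) (simp_all add: dist_norm)
      then have "continuous_on UNIV (G t)" by (rule lipschitz_on_continuous_on)
      moreover have "continuous_on {0..t} (\<lambda>r. T t r v)"
        using that by (intro continuous_T_right) (simp add: t_def)
      ultimately show ?thesis by (rule continuous_on_compose2) simp
    qed
    then have "continuous_on {0..t} (\<lambda>r. G r v)"
      by (rule continuous_on_eq) (simp add: G_T)
    then have "continuous (at s within {0..t}) (\<lambda>r. G r v)"
      using that by (simp add: continuous_on_eq_continuous_within t_def)
    moreover have "at s within {0..} = at s within {0..t}"
      by (rule at_within_nhd[of _ "{..<t}"]) (use that in \<open>auto simp: t_def\<close>)
    ultimately show ?thesis by simp
  qed
  then show ?thesis by (simp add: continuous_on_eq_continuous_within)
qed

section \<open>Measurability of the kernels, Green's estimate and uniqueness of bounded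
  orbits\<close>

lemma continuous_on_max_0:
  "continuous_on {0..} f \<Longrightarrow> continuous_on UNIV (\<lambda>\<tau>::real. f (max 0 \<tau>))"
  by (rule continuous_on_compose2[OF _ continuous_on_max[OF continuous_on_const continuous_on_id]]) auto

lemma bochner_measurable_N:
  assumes "bochner_measurable lebesgue y"
  shows "bochner_measurable lebesgue (\<lambda>\<tau>. N (max 0 \<tau>) (y \<tau>))"
proof (rule bochner_measurable_lebesgue_Lipschitz[OF _ _ _ assms])
  show "norm (N (max 0 \<tau>) v - N (max 0 \<tau>) w) \<le> \<kappa> (max 0 \<tau>) * norm (v - w)" for \<tau> v w
    using is_norm_abs_diff_le[OF is_norm, of "max 0 \<tau>" v w] N_le_kappa[of "max 0 \<tau>" "v - w"] by simp
qed (intro continuous_on_max_0 continuous_N continuous_kappa)+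

lemma bochner_measurable_G:
  assumes "bochner_measurable lebesgue y"
  shows "bochner_measurable lebesgue (\<lambda>\<tau>. G (max 0 \<tau>) (y \<tau>))"
proof (rule bochner_measurable_lebesgue_Lipschitz[OF _ _ _ assms])
  show "continuous_on UNIV (\<lambda>\<tau>. D * \<kappa> (max 0 \<tau>))"
    by (intro continuous_on_mult_left continuous_on_max_0 continuous_kappa)
  show "norm (G (max 0 \<tau>) v - G (max 0 \<tau>) w) \<le> D * \<kappa> (max 0 \<tau>) * norm (v - w)" for \<tau> v w
    using norm_G_le[of "max 0 \<tau>" "v - w"] G_diff[of "max 0 \<tau>" v w] by simp
qed (intro continuous_on_max_0 continuous_G)

text \<open>Clamping time to \<open>[0,t]\<close> keeps the kernel where the evolution family is
  constrained. Its values for \<tau> > t are artificial and are later removed by an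
  indicator.\<close>

lemma bochner_measurable_T:
  assumes "0 \<le> t" "bochner_measurable lebesgue y"
  shows "bochner_measurable lebesgue (\<lambda>\<tau>. T t (min t (max 0 \<tau>)) (y \<tau>))"
proof (rule bochner_measurable_lebesgue_Lipschitz[OF _ _ _ assms(2)])
  have c: "continuous_on UNIV (\<lambda>\<tau>. min t (max 0 \<tau>))" by (intro continuous_intros)
  show "continuous_on UNIV (\<lambda>\<tau>. T t (min t (max 0 \<tau>)) v)" for v
    by (rule continuous_on_compose2[OF continuous_T_right c]) (use assms in auto)
  have "continuous_on UNIV (\<lambda>\<tau>. \<kappa> (min t (max 0 \<tau>)))"
    by (rule continuous_on_compose2[OF continuous_kappa c]) (use assms in auto)
  then show "continuous_on UNIV (\<lambda>\<tau>. (1 + norm (T t 0)) * (D * \<kappa> (min t (max 0 \<tau>))))"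
    by (intro continuous_on_mult_left)
  show "norm (T t (min t (max 0 \<tau>)) v - T t (min t (max 0 \<tau>)) w)
      \<le> (1 + norm (T t 0)) * (D * \<kappa> (min t (max 0 \<tau>))) * norm (v - w)" for \<tau> v w
    using norm_T_le[of "min t (max 0 \<tau>)" t "v - w"] assms(1) by (simp add: blinfun.diff_right)
qed

text \<open>Green's kernel: for \<open>\<tau> \<le> t\<close> the difference is \<open>T(t,\<tau>) P(\<tau>) v\<close>, and for \<open>\<tau> > t\<close> the subtrahend is
  \<open>T(t,\<tau>) (Id - P(\<tau>)) v\<close>.\<close>

definition green :: "real \<Rightarrow> real \<Rightarrow> 'a \<Rightarrow> 'a"
  where "green t \<tau> v = indicator {..t} \<tau> *\<^sub>R T t \<tau> v - T t 0 (G \<tau> v)"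

text \<open>The constant does not depend on \<open>t\<close>; this is what bounds Green's operator
  from Y_1 into Y_infinity.\<close>

lemma green_le:
  assumes "0 \<le> t" "0 \<le> \<tau>"
  shows "N t (green t \<tau> v) \<le> D * N \<tau> v"
proof (cases "\<tau> \<le> t")
  case True
  then show ?thesis using stable_le[of \<tau> t v] assms by (simp add: green_def)
next
  case False
  have "N t (- T t 0 (G \<tau> v)) = N t (T t 0 (G \<tau> v))"
    using is_norm_scaleR[OF is_norm, of t "-1" "T t 0 (G \<tau> v)"] assms by simp
  with False show ?thesis using unstable_le[of t \<tau> v] assms by (simp add: green_def)
qed

text \<open>The backward estimate from \<open>t\<close> to 0 recovers \<open>z\<close> from its
  orbit point, giving \<open>N 0 z \<le> D * exp (- l * (\<rho> t - \<rho> 0)) * B\<close>. The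
  right-hand side tends to 0 because \<rho> tends to infinity.\<close>

lemma homogeneous_bounded_eq_0:
  assumes rho: "filterlim \<rho> at_top at_top"
    and z: "P 0 z = 0" and B: "\<And>t. 0 \<le> t \<Longrightarrow> N t (T t 0 z) \<le> B"
  shows "z = 0"
proof -
  have "N 0 z \<le> D * exp (- l * (\<rho> t - \<rho> 0)) * B" if "0 \<le> t" for t
  proof -
    have "P t (T t 0 z) = 0" using T_P[of 0 t z] z that by (simp add: blinfun.zero_right)
    then have "backward_evolution T P 0 t (T t 0 z - P t (T t 0 z)) = z"
      using backward_evolution_T[of 0 t z] z that by simp
    then have "N 0 z \<le> D * exp (- l * (\<rho> t - \<rho> 0)) * N t (T t 0 z)"
      using unstable[of 0 t "T t 0 z"] that by simp
    also have "\<dots> \<le> D * exp (- l * (\<rho> t - \<rho> 0)) * B"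
      using D_pos B[OF that] by (intro mult_left_mono) auto
    finally show ?thesis .
  qed
  then have ev: "eventually (\<lambda>t. N 0 z \<le> D * exp (- l * (\<rho> t - \<rho> 0)) * B) at_top"
    using eventually_ge_at_top[of 0] by (rule eventually_mono[rotated])
  have "filterlim (\<lambda>t. - \<rho> 0 + \<rho> t) at_top at_top"
    by (rule filterlim_tendsto_add_at_top[OF tendsto_const rho])
  then have "filterlim (\<lambda>t. \<rho> t - \<rho> 0) at_top at_top" by (simp add: algebra_simps)
  then have "filterlim (\<lambda>t. - l * (\<rho> t - \<rho> 0)) at_bot at_top"
    using l_pos by (intro filterlim_tendsto_neg_mult_at_bot[OF tendsto_const]) auto
  then have "((\<lambda>t. exp (- l * (\<rho> t - \<rho> 0))) \<longlongrightarrow> 0) at_top"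
    by (rule filterlim_compose[OF exp_at_bot])
  then have "((\<lambda>t. D * exp (- l * (\<rho> t - \<rho> 0)) * B) \<longlongrightarrow> D * 0 * B) at_top"
    by (intro tendsto_intros)
  then have "N 0 z \<le> D * 0 * B" by (rule tendsto_lowerbound[OF _ ev]) simp
  with norm_le_N[of 0 z] have "norm z \<le> 0" by linarith
  then show ?thesis by simp
qed

section \<open>Green's formula: boundedness, continuity, initial value and variation of
  constants\<close>

text \<open>Elements of \<open>Y\<^sub>1\<close> are extended by zero to negative times, so that every integral below is one
  over \<^term>\<open>lebesgue\<close>; \<open>max 0 \<tau>\<close> makes the kernels continuous on the whole line.\<close>

context
  fixes y :: "real \<Rightarrow> 'a"
  assumes y: "bochner_measurable lebesgue y"
    and y_eq_0: "\<And>\<tau>. \<tau> < 0 \<Longrightarrow> y \<tau> = 0"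
    and finite_integral: "(\<integral>\<^sup>+\<tau>. N (max 0 \<tau>) (y \<tau>) \<partial>lebesgue) < \<infinity>"
begin

definition integrand :: "real \<Rightarrow> real \<Rightarrow> 'a"
  where "integrand t \<tau> = green t (max 0 \<tau>) (y \<tau>)"

definition solution :: "real \<Rightarrow> 'a"
  where "solution t = banach_bochner_integral lebesgue (integrand t)"

lemma finite_mult:
  assumes "0 \<le> c"
  shows "(\<integral>\<^sup>+\<tau>. ennreal (c * N (max 0 \<tau>) (y \<tau>)) \<partial>lebesgue) < \<infinity>"
  using nn_integral_linear_bochner_measurable[OF bochner_measurable_simple bochner_measurable_N[OF y], of "\<lambda>_. 0" c]
    finite_integral assms N_nonneg by (simp add: ennreal_mult_less_top)

lemma bochner_measurable_mult_N:
  "bochner_measurable lebesgue (\<lambda>\<tau>. c * N (max 0 \<tau>) (y \<tau>))"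
  using bochner_measurable_scaleR[OF _ bochner_measurable_N[OF y], of "\<lambda>_. c"] by simp

lemma integrand_eq_0: "0 \<le> t \<Longrightarrow> \<tau> < 0 \<Longrightarrow> integrand t \<tau> = 0"
  by (simp add: integrand_def green_def y_eq_0 blinfun.zero_right G_zero)

lemma N_integrand_le: "0 \<le> t \<Longrightarrow> N t (integrand t \<tau>) \<le> D * N (max 0 \<tau>) (y \<tau>)"
  unfolding integrand_def by (rule green_le) simp_all

lemma norm_integrand_le: "0 \<le> t \<Longrightarrow> norm (integrand t \<tau>) \<le> D * N (max 0 \<tau>) (y \<tau>)"
  using norm_le_N N_integrand_le order_trans by blast

lemma bochner_measurable_integrand:
  assumes "0 \<le> t"
  shows "bochner_measurable lebesgue (integrand t)"
proof -
  \<comment> \<open>Clamping by \<open>t\<close> is harmless since the indicator vanishes for \<tau>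
    > t, and as \<open>t\<close> is nonnegative the indicator takes the same value at
    \<open>\<tau>\<close> and \<open>max 0 \<tau>\<close>.\<close>
  have eq: "integrand t = (\<lambda>\<tau>. indicator {..t} \<tau> *\<^sub>R T t (min t (max 0 \<tau>)) (y \<tau>) - T t 0 (G (max 0 \<tau>) (y \<tau>)))"
  proof
    fix \<tau>
    show "integrand t \<tau> = indicator {..t} \<tau> *\<^sub>R T t (min t (max 0 \<tau>)) (y \<tau>) - T t 0 (G (max 0 \<tau>) (y \<tau>))"
      using assms by (cases "max 0 \<tau> \<le> t") (simp_all add: integrand_def green_def)
  qed
  have "bochner_measurable lebesgue (\<lambda>\<tau>. indicator {..t} \<tau> *\<^sub>R T t (min t (max 0 \<tau>)) (y \<tau>))"
    by (intro bochner_measurable_scaleR bochner_measurable_T assms y borel_measurable_indicator) simp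
  moreover have "bochner_measurable lebesgue (\<lambda>\<tau>. T t 0 (G (max 0 \<tau>) (y \<tau>)))"
    by (rule bochner_measurable_compose[OF bochner_measurable_G[OF y]])
      (rule blinfun.continuous_on[OF continuous_on_const continuous_on_id])
  ultimately show ?thesis unfolding eq by (rule bochner_measurable_diff)
qed

lemma has_integral_solution:
  assumes "0 \<le> t"
  shows "has_banach_bochner_integral lebesgue (integrand t) (solution t)"
proof -
  have "(\<integral>\<^sup>+\<tau>. norm (integrand t \<tau>) \<partial>lebesgue) \<le> (\<integral>\<^sup>+\<tau>. ennreal (D * N (max 0 \<tau>) (y \<tau>)) \<partial>lebesgue)"
    by (intro nn_integral_mono ennreal_leI norm_integrand_le assms)
  also have "\<dots> < \<infinity>" using finite_mult D_pos by simp
  finally obtain I where I: "has_banach_bochner_integral lebesgue (integrand t) I"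
    using has_banach_bochner_integral_exists[OF bochner_measurable_integrand[OF assms]] by blast
  with banach_bochner_integral_eq[OF I] show ?thesis by (simp add: solution_def)
qed

text \<open>The norm inequality is applied in \<open>N t\<close> itself rather than in the ambient
  norm, so the resulting bound is independent of \<open>t\<close>.\<close>

lemma N_solution_le:
  assumes "0 \<le> t"
  shows "N t (solution t) \<le> enn2real (\<integral>\<^sup>+\<tau>. ennreal (D * N (max 0 \<tau>) (y \<tau>)) \<partial>lebesgue)"
proof -
  have "ennreal (N t (solution t)) \<le> (\<integral>\<^sup>+\<tau>. N t (integrand t \<tau>) \<partial>lebesgue)"
    by (rule has_banach_bochner_integral_is_norm_le[OF is_norm N_le_kappa has_integral_solution]) (use assms in simp_all)
  also have "\<dots> \<le> (\<integral>\<^sup>+\<tau>. ennreal (D * N (max 0 \<tau>) (y \<tau>)) \<partial>lebesgue)"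
    by (intro nn_integral_mono ennreal_leI N_integrand_le assms)
  finally show ?thesis
    using finite_mult[of D] D_pos N_nonneg[OF assms] enn2real_mono by fastforce
qed

lemma AE_lebesgue_neq: "AE \<tau> in lebesgue. \<tau> \<noteq> (a::real)"
  by (intro AE_completion AE_lborel_singleton)

text \<open>For each \<tau> other than \<open>a\<close> the integrand converges as time tends to
  \<open>a\<close>; the jump of Green's kernel sits at the single point \<tau> = a. The dominating
  constant \<open>2 * D\<close> adds the bounds of the two integrands.\<close>

lemma continuous_solution: "continuous_on {0..} solution"
  unfolding continuous_on_sequentially
proof (intro allI ballI impI, elim conjE)
  fix u :: "nat \<Rightarrow> real" and a
  assume a: "a \<in> {0..}" and u: "\<forall>n. u n \<in> {0..}" and lim: "u \<longlonglongrightarrow> a"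
  have "(\<lambda>n. solution (u n)) \<longlonglongrightarrow> solution a"
  proof (rule has_banach_bochner_integral_dominated_convergence[where w="\<lambda>\<tau>. (2 * D) * N (max 0 \<tau>) (y \<tau>)"])
    show "has_banach_bochner_integral lebesgue (integrand (u n)) (solution (u n))" for n
      using u by (intro has_integral_solution) simp
    show "has_banach_bochner_integral lebesgue (integrand a) (solution a)"
      using a by (intro has_integral_solution) simp
    show "AE \<tau> in lebesgue. norm (integrand (u n) \<tau> - integrand a \<tau>) \<le> 2 * D * N (max 0 \<tau>) (y \<tau>)" for n
    proof (rule AE_I2)
      fix \<tau>
      show "norm (integrand (u n) \<tau> - integrand a \<tau>) \<le> 2 * D * N (max 0 \<tau>) (y \<tau>)"
        using norm_triangle_ineq4[of "integrand (u n) \<tau>" "integrand a \<tau>"]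
          norm_integrand_le[of "u n" \<tau>] norm_integrand_le[of a \<tau>] a u by simp
    qed
    show "AE \<tau> in lebesgue. (\<lambda>n. integrand (u n) \<tau>) \<longlonglongrightarrow> integrand a \<tau>"
      using AE_lebesgue_neq[of a]
    proof eventually_elim
      case (elim \<tau>)
      \<comment> \<open>The sequence may approach \<open>a\<close> from below, so \<open>u n\<close>
        must eventually stay in \<open>{r..}\<close>, where continuity of the orbit is
        given.\<close>
      have cont: "(\<lambda>n. T (u n) r v) \<longlonglongrightarrow> T a r v" if "0 \<le> r" "r \<le> a" "\<forall>\<^sub>F n in sequentially. r \<le> u n" for r v
        using continuous_on_tendsto_compose[OF continuous_T_left[OF that(1), of v] lim] that by simp
      have cont0: "(\<lambda>n. T (u n) 0 v) \<longlonglongrightarrow> T a 0 v" for v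
        using a u by (intro cont) simp_all
      consider "\<tau> < 0" | "0 \<le> \<tau>" "\<tau> < a" | "0 \<le> \<tau>" "a < \<tau>" using elim by linarith
      then show ?case
      proof cases
        case 1
        then show ?thesis using integrand_eq_0 a u by simp
      next
        case 2
        have ev: "\<forall>\<^sub>F n in sequentially. \<tau> < u n" by (rule order_tendstoD(1)[OF lim 2(2)])
        then have eq: "\<forall>\<^sub>F n in sequentially. T (u n) \<tau> (y \<tau>) - T (u n) 0 (G \<tau> (y \<tau>)) = integrand (u n) \<tau>"
          by eventually_elim (use 2 in \<open>simp add: integrand_def green_def\<close>)
        have "(\<lambda>n. T (u n) \<tau> (y \<tau>) - T (u n) 0 (G \<tau> (y \<tau>))) \<longlonglongrightarrow> T a \<tau> (y \<tau>) - T a 0 (G \<tau> (y \<tau>))"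
          using 2 eventually_mono[OF ev less_imp_le] by (intro tendsto_diff cont cont0) simp_all
        moreover have "integrand a \<tau> = T a \<tau> (y \<tau>) - T a 0 (G \<tau> (y \<tau>))"
          using 2 by (simp add: integrand_def green_def)
        ultimately show ?thesis using eq by (simp only: Lim_transform_eventually)
      next
        case 3
        have "\<forall>\<^sub>F n in sequentially. u n < \<tau>" by (rule order_tendstoD(2)[OF lim 3(2)])
        then have eq: "\<forall>\<^sub>F n in sequentially. - T (u n) 0 (G \<tau> (y \<tau>)) = integrand (u n) \<tau>"
          by eventually_elim (use 3 in \<open>simp add: integrand_def green_def\<close>)
        have "(\<lambda>n. - T (u n) 0 (G \<tau> (y \<tau>))) \<longlonglongrightarrow> - T a 0 (G \<tau> (y \<tau>))"
          by (intro tendsto_minus cont0)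
        moreover have "integrand a \<tau> = - T a 0 (G \<tau> (y \<tau>))"
          using 3 by (simp add: integrand_def green_def)
        ultimately show ?thesis using eq by (simp only: Lim_transform_eventually)
      qed
    qed
  qed (use finite_mult[of "2 * D"] D_pos bochner_measurable_mult_N in simp_all)
  then show "(solution \<circ> u) \<longlonglongrightarrow> solution a" by (simp add: comp_def)
qed

text \<open>For \<tau> > 0 the integrand at time 0 is \<open>- G \<tau> (y \<tau>)\<close>,
  annihilated by \<open>P 0\<close>; for \<tau> < 0 it vanishes. The bounded operator
  \<open>P 0\<close> passes under the integral.\<close>

lemma P_solution: "P 0 (solution 0) = 0"
proof -
  have "AE \<tau> in lebesgue. norm (P 0 (integrand 0 \<tau>)) = 0"
    using AE_lebesgue_neq[of 0]
  proof eventually_elim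
    case (elim \<tau>)
    then show ?case
      by (cases "\<tau> < 0")
        (simp_all add: integrand_def green_def y_eq_0 G_zero T_refl P_G blinfun.zero_right blinfun.minus_right)
  qed
  then have "(\<integral>\<^sup>+\<tau>. norm (P 0 (integrand 0 \<tau>)) \<partial>lebesgue) = (\<integral>\<^sup>+\<tau>. 0 \<partial>(lebesgue :: real measure))"
    by (intro nn_integral_cong_AE, eventually_elim) simp
  moreover have "ennreal (norm (P 0 (solution 0))) \<le> (\<integral>\<^sup>+\<tau>. norm (P 0 (integrand 0 \<tau>)) \<partial>lebesgue)"
    by (rule has_banach_bochner_integral_is_norm_le[OF is_norm_norm, of 1])
      (simp_all add: has_banach_bochner_integral_bounded_linear[OF blinfun.bounded_linear_right] has_integral_solution)
  ultimately show ?thesis by simp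
qed

text \<open>Applying \<open>T t s\<close> to the integrand at time \<open>s\<close> reproduces the
  Green term at time \<open>t\<close> and the part with \<tau> < s. Both cancel in the difference,
  which leaves the integrand over \<open>[s,t]\<close>.\<close>

lemma has_integral_variation_of_constants:
  assumes "0 \<le> s" "s \<le> t"
  shows "has_banach_bochner_integral (lebesgue_on {s..t}) (\<lambda>\<tau>. T t \<tau> (y \<tau>)) (solution t - T t s (solution s))"
proof (rule has_banach_bochner_integral_restrict_spaceI)
  \<comment> \<open>The point \<tau> = s is excluded: both indicators \<open>{..s}\<close> and
    \<open>{..t}\<close> contain it, so the left side cancels there while \<open>{s..t}\<close>
    keeps it.\<close>
  have AE: "AE \<tau> in lebesgue. integrand t \<tau> - T t s (integrand s \<tau>) = indicator {s..t} \<tau> *\<^sub>R T t \<tau> (y \<tau>)"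
    using AE_lebesgue_neq[of s]
  proof eventually_elim
    case (elim \<tau>)
    consider "\<tau> < 0" | "0 \<le> \<tau>" "\<tau> < s" | "s < \<tau>" "\<tau> \<le> t" | "t < \<tau>" using elim by linarith
    then show ?case
    proof cases
      case 1
      then show ?thesis using assms by (simp add: integrand_eq_0 y_eq_0 blinfun.zero_right)
    qed (use assms T_trans[of 0 s t] T_trans[of \<tau> s t] in
        \<open>simp_all add: integrand_def green_def blinfun.diff_right blinfun.minus_right\<close>)
  qed
  have "has_banach_bochner_integral lebesgue (\<lambda>\<tau>. integrand t \<tau> - T t s (integrand s \<tau>)) (solution t - T t s (solution s))"
    by (intro has_banach_bochner_integral_diff has_integral_solution
        has_banach_bochner_integral_bounded_linear[OF blinfun.bounded_linear_right]) (use assms in simp_all)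
  then show "has_banach_bochner_integral lebesgue (\<lambda>\<tau>. indicator {s..t} \<tau> *\<^sub>R T t \<tau> (y \<tau>)) (solution t - T t s (solution s))"
    by (rule has_banach_bochner_integral_cong_AE[OF _ AE])
  \<comment> \<open>The two terms come from \<open>integrand t\<close> and from \<open>T t s\<close>
    applied to \<open>integrand s\<close>.\<close>
  define K where "K = D + norm (T t s) * D"
  have "AE \<tau> in lebesgue. norm (indicator {s..t} \<tau> *\<^sub>R T t \<tau> (y \<tau>)) \<le> K * N (max 0 \<tau>) (y \<tau>)"
    using AE
  proof eventually_elim
    case (elim \<tau>)
    have "norm (integrand t \<tau> - T t s (integrand s \<tau>)) \<le> norm (integrand t \<tau>) + norm (T t s (integrand s \<tau>))"
      by (rule norm_triangle_ineq4)
    also have "\<dots> \<le> D * N (max 0 \<tau>) (y \<tau>) + norm (T t s) * (D * N (max 0 \<tau>) (y \<tau>))"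
      using assms by (intro add_mono norm_integrand_le order_trans[OF norm_blinfun mult_left_mono]) auto
    finally show ?case by (simp add: elim K_def algebra_simps)
  qed
  then have "(\<integral>\<^sup>+\<tau>. norm (indicator {s..t} \<tau> *\<^sub>R T t \<tau> (y \<tau>)) \<partial>lebesgue)
      \<le> (\<integral>\<^sup>+\<tau>. ennreal (K * N (max 0 \<tau>) (y \<tau>)) \<partial>lebesgue)"
    by (intro nn_integral_mono_AE, eventually_elim) (rule ennreal_leI)
  also have "\<dots> < \<infinity>" using finite_mult[of K] D_pos by (simp add: K_def)
  finally show "(\<integral>\<^sup>+\<tau>. norm (indicator {s..t} \<tau> *\<^sub>R T t \<tau> (y \<tau>)) \<partial>lebesgue) < \<infinity>" .
qed simp

end

end

section \<open>Existence and uniqueness of the bounded solution with initial value in the kernel of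
  \<open>P 0\<close>\<close>

theorem proposition2:
  fixes T :: "real \<Rightarrow> real \<Rightarrow> 'a::banach \<Rightarrow>\<^sub>L 'a"
    and P :: "real \<Rightarrow> 'a \<Rightarrow>\<^sub>L 'a"
    and N :: "real \<Rightarrow> 'a \<Rightarrow> real"
    and \<rho> \<rho>' :: "real \<Rightarrow> real"
    and C \<epsilon> :: real
    and Z :: "'a set"
  assumes "evolution_family T"
    and "\<rho> \<in> {0..} \<rightarrow> {0..}"
    and "strict_mono_on {0..} \<rho>"
    and "\<And>t. t \<ge> 0 \<Longrightarrow> (\<rho> has_real_derivative \<rho>' t) (at t within {0..})"
    and "continuous_on {0..} \<rho>'"
    and "\<rho> 0 = 0"
    and "filterlim \<rho> at_top at_top"
    and "\<And>t. t \<ge> 0 \<Longrightarrow> is_norm (N t)"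
    and "\<And>x. continuous_on {0..} (\<lambda>t. N t x)"
    and "C > 0" and "\<epsilon> \<ge> 0"
    and "\<And>x t. t \<ge> 0 \<Longrightarrow> norm x \<le> N t x \<and> N t x \<le> C * exp (\<epsilon> * \<rho> t) * norm x"
    and "rho_dichotomy \<rho> N T P"
    and "Z = blinfun_ker (P 0)"
  shows "\<forall>y\<in>Y_one N. \<exists>!x. x \<in> Y_infty_sub N Z \<and>
           (\<forall>t s. 0 \<le> s \<and> s \<le> t \<longrightarrow>
              banach_bochner_integrable (lebesgue_on {s..t}) (\<lambda>\<tau>. blinfun_apply (T t \<tau>) (y \<tau>)) \<and>
              x t = blinfun_apply (T t s) (x s)
                    + banach_bochner_integral (lebesgue_on {s..t})
                        (\<lambda>\<tau>. blinfun_apply (T t \<tau>) (y \<tau>)))"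
proof
  fix y assume "y \<in> Y_one N"
  then have ym: "bochner_measurable (lebesgue_on {0..}) y"
    and yfin: "(\<integral>\<^sup>+ t. ennreal (N t (y t)) \<partial>lebesgue_on {0..}) < \<infinity>"
    by (auto simp: Y_one_def)
  note dichotomy = assms(13)[unfolded rho_dichotomy_def]
  obtain l D where lD: "0 < l" "0 < D" and bounds: "\<forall>x.
      (\<forall>t s. 0 \<le> s \<and> s \<le> t \<longrightarrow> N t (T t s (P s x)) \<le> D * exp (- l * (\<rho> t - \<rho> s)) * N s x) \<and>
      (\<forall>t s. 0 \<le> t \<and> t \<le> s \<longrightarrow>
        N t (backward_evolution T P t s (x - P s x)) \<le> D * exp (- l * (\<rho> s - \<rho> t)) * N s x)"
    using dichotomy by (elim conjE exE) (rule that)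
  have "continuous_on {0..} \<rho>"
    using assms(4) by (intro DERIV_continuous_on) simp
  then have kappa: "continuous_on {0..} (\<lambda>t. C * exp (\<epsilon> * \<rho> t))"
    by (intro continuous_intros)
  interpret dichotomic_family T P N \<rho> "\<lambda>t. C * exp (\<epsilon> * \<rho> t)" l D
  proof
    show "mono_on {0..} \<rho>" using assms(3) by (rule strict_mono_on_imp_mono_on)
    show "norm x \<le> N t x" "N t x \<le> C * exp (\<epsilon> * \<rho> t) * norm x" if "0 \<le> t" for t x
      using assms(12)[OF that] by blast+
    show "P t o\<^sub>L P t = P t" if "0 \<le> t" for t
      using dichotomy that by (elim conjE) simp
    show "T t s o\<^sub>L P s = P t o\<^sub>L T t s"
      "bij_betw (blinfun_apply (T t s)) (blinfun_ker (P s)) (blinfun_ker (P t))" if "0 \<le> s" "s \<le> t" for s t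
      using dichotomy that by (elim conjE, simp)+
    show "N t (T t s (P s x)) \<le> D * exp (- l * (\<rho> t - \<rho> s)) * N s x" if "0 \<le> s" "s \<le> t" for s t x
      using bounds that by blast
    show "N t (backward_evolution T P t s (x - P s x)) \<le> D * exp (- l * (\<rho> s - \<rho> t)) * N s x"
      if "0 \<le> t" "t \<le> s" for t s x
      using bounds that by blast
  qed (use assms(1,8,9) lD kappa in simp_all)
  define y0 where "y0 \<tau> = indicator {0..} \<tau> *\<^sub>R y \<tau>" for \<tau>
  have y0: "bochner_measurable lebesgue y0" "\<And>\<tau>. \<tau> < 0 \<Longrightarrow> y0 \<tau> = 0"
    using ym by (simp_all add: y0_def[abs_def] bochner_measurable_restrict_space)
  \<comment> \<open>At negative times the left side is \<open>N 0 0 = 0\<close>, so the extension by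
    zero keeps the Y_1 norm.\<close>
  have "N (max 0 \<tau>) (y0 \<tau>) = N \<tau> (y \<tau>) * indicator {0..} \<tau>" for \<tau>
    using is_norm_eq_0_iff[OF is_norm[of 0], of 0] by (simp add: y0_def indicator_def max_def)
  then have "(\<integral>\<^sup>+\<tau>. N (max 0 \<tau>) (y0 \<tau>) \<partial>lebesgue) = (\<integral>\<^sup>+ t. ennreal (N t (y t)) \<partial>lebesgue_on {0..})"
    by (auto simp: nn_integral_restrict_space indicator_def intro!: nn_integral_cong)
  with yfin have y0fin: "(\<integral>\<^sup>+\<tau>. N (max 0 \<tau>) (y0 \<tau>) \<partial>lebesgue) < \<infinity>" by simp
  note y0 = y0 y0fin
  let ?eq = "\<lambda>x. \<forall>t s. 0 \<le> s \<and> s \<le> t \<longrightarrow>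
              banach_bochner_integrable (lebesgue_on {s..t}) (\<lambda>\<tau>. T t \<tau> (y \<tau>)) \<and>
              x t = T t s (x s) + banach_bochner_integral (lebesgue_on {s..t}) (\<lambda>\<tau>. T t \<tau> (y \<tau>))"
  \<comment> \<open>The value \<open>undefined\<close> at negative times places \<open>x\<close> in
    \<open>extensional {0..}\<close>.\<close>
  define x where "x t = (if 0 \<le> t then solution y0 t else undefined)" for t
  have int: "has_banach_bochner_integral (lebesgue_on {s..t}) (\<lambda>\<tau>. T t \<tau> (y \<tau>)) (x t - T t s (x s))"
    if "0 \<le> s" "s \<le> t" for s t
  proof -
    have "has_banach_bochner_integral (lebesgue_on {s..t}) (\<lambda>\<tau>. T t \<tau> (y0 \<tau>)) (x t - T t s (x s))"
      using has_integral_variation_of_constants[OF y0 that] that by (simp add: x_def)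
    then show ?thesis
      by (rule has_banach_bochner_integral_cong_AE) (use that in \<open>auto simp: y0_def intro!: AE_I2\<close>)
  qed
  have "x \<in> Y_infty_sub N Z"
    unfolding Y_infty_sub_def Y_infty_def
  proof (intro CollectI conjI)
    show "x \<in> extensional {0..}" by (simp add: x_def extensional_def)
    show "continuous_on {0..} x"
      using continuous_solution[OF y0]
    proof (rule continuous_on_eq)
      fix t :: real assume "t \<in> {0..}"
      then show "solution y0 t = x t" by (simp add: x_def)
    qed
    show "bdd_above ((\<lambda>t. N t (x t)) ` {0..})"
      by (rule bdd_aboveI2) (use N_solution_le[OF y0] in \<open>simp add: x_def\<close>)
    show "x 0 \<in> Z"
      using P_solution[OF y0] by (simp add: x_def assms(14) blinfun_ker_def)
  qed
  moreover have "?eq x"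
    using int by (auto simp: banach_bochner_integrable_def banach_bochner_integral_eq[OF int])
  moreover have "x' = x''"
    if mem: "x' \<in> Y_infty_sub N Z" "x'' \<in> Y_infty_sub N Z" and eqs: "?eq x'" "?eq x''" for x' x''
  proof -
    define z where "z = x' 0 - x'' 0"
    \<comment> \<open>Taking the initial time 0 in both equations makes the inhomogeneous integrals
      cancel.\<close>
    have diff: "x' t - x'' t = T t 0 z" if "0 \<le> t" for t
    proof -
      have "x' t = T t 0 (x' 0) + banach_bochner_integral (lebesgue_on {0..t}) (\<lambda>\<tau>. T t \<tau> (y \<tau>))"
        using eqs(1) that by blast
      moreover have "x'' t = T t 0 (x'' 0) + banach_bochner_integral (lebesgue_on {0..t}) (\<lambda>\<tau>. T t \<tau> (y \<tau>))"
        using eqs(2) that by blast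
      ultimately show ?thesis by (simp add: z_def blinfun.diff_right)
    qed
    obtain B' B'' where B: "\<And>t. 0 \<le> t \<Longrightarrow> N t (x' t) \<le> B'" "\<And>t. 0 \<le> t \<Longrightarrow> N t (x'' t) \<le> B''"
      using mem unfolding Y_infty_sub_def Y_infty_def bdd_above_def by auto
    have "z = 0"
    proof (rule homogeneous_bounded_eq_0[OF assms(7)])
      show "P 0 z = 0"
        using mem by (simp add: z_def Y_infty_sub_def assms(14) blinfun_ker_def blinfun.diff_right)
      fix t :: real assume t: "0 \<le> t"
      have "N t (x' t) \<ge> N t (x' t - x'' t) - N t (x'' t)"
        using is_norm_triangle[OF is_norm[OF t], of "x' t" "- x'' t"]
          is_norm_scaleR[OF is_norm[OF t], of "-1" "x'' t"] by simp
      then show "N t (T t 0 z) \<le> B' + B''"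
        using B[OF t] diff[OF t] by simp
    qed
    then have "x' t = x'' t" if "0 \<le> t" for t
      using diff[OF that] by (simp add: blinfun.zero_right)
    \<comment> \<open>Equality on \<open>[0,\<infinity>)\<close> becomes equality of functions
      because both are extensional.\<close>
    with mem show ?thesis
      by (intro extensionalityI[of x' "{0..}" x'']) (auto simp: Y_infty_sub_def Y_infty_def)
  qed
  ultimately show "\<exists>!x. x \<in> Y_infty_sub N Z \<and> ?eq x" by blast
qed

end
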